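(* Let $\varphi:X\to X$ be a self-map and assume that one of the following holds: (1) $X$ is a compact metric space and $\varphi$ is continuous; (2) $X$ is a limit group of free groups and $\varphi$ is a group endomorphism of $X$; (3) $S$ is a finite set, $\sigma:S\to S^*$ is a substitution, and either $X=S^*$ is the set of finite words over $S$ and $\varphi=\sigma_*$, or $X=S^\omega_\infty$ and $\varphi=\sigma_\omega$ is the induced map on infinite words (where $S^\omega_\infty$ is the set $S^\omega$ of all infinite words when $\sigma$ is non-erasing). Then $\operatorname{Stab}(\varphi)=\operatorname{Atrac}(\varphi)$.
   Context: For a set $X$ and a map $\varphi:X\to X$: the stable set is $$\operatorname{Stab}(\varphi)=\{x\in X\mid \exists (x_n)_{n\ge 0}\text{ in }X,\ x_0=x\text{ and }\varphi(x_{n+1})=x_n\text{ for all }n\ge 0\},$$ and the attracting set is $\operatorname{Atrac}(\varphi)=\bigcap_{n\in\mathbb{N}}\varphi^n(X)$. Limit groups of free groups. Let $F_n$ be the free group of rank $n$. A marked group is a pair $(G,p)$ with $G$ a group and $p:F_n\to G$ a surjective homomorphism; two marked groups $(G,p)$, $(G',p')$ are identified when there is a group isomorphism $\theta:G\to G'$ with $p'=\theta\circ p$. The set $\mathcal{G}_n$ of marked groups is identified with a subset of $\{0,1\}^{F_n}$ (the set of subsets of $F_n$) via $(G,p)\mapsto \ker p$, and carries the topology induced by the product topology. A limit group of free groups is a group $G$ such that, for some positive integer $n$, there is a marked group $(G,p)$ lying in the closure in $\mathcal{G}_n$ of the set of marked groups $(F_m,q)$ with $F_m$ a free group of finite rank.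 Substitutions. $S^*$ is the free monoid of finite words over $S$, $\varepsilon$ is the empty word, and $S^\omega$ is the set of infinite words $s_1s_2s_3\cdots$ over $S$. A substitution is a map $\sigma:S\to S^*$; it extends to the monoid endomorphism $\sigma_*:S^*\to S^*$, $\sigma_*(s_1\cdots s_n)=\sigma(s_1)\cdots\sigma(s_n)$. A letter $s\in S$ is mortal if $\sigma_*^n(s)=\varepsilon$ for some $n\ge1$, and immortal otherwise; $\sigma$ is non-erasing if there are no mortal letters. $S^\omega_\infty\subseteq S^\omega$ is the set of infinite words containing infinitely many occurrences of immortal letters, and $\sigma_\omega:S^\omega_\infty\to S^\omega_\infty$ is defined by $\sigma_\omega(s_1s_2\cdots)=\sigma(s_1)\sigma(s_2)\cdots$. *)

theory Defs
  imports
    "HOL-Analysis.Abstract_Metric_Spaces"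
    "HOL-Algebra.Coset"
    "HOL-Library.Stream"
begin

section \<open>Stable and attracting sets\<close>

text \<open>The set \<open>X\<close> is a carrier inside a type; these definitions are meant for maps with
  \<open>\<phi> \<in> X \<rightarrow> X\<close>.\<close>

definition Stab :: "'a set \<Rightarrow> ('a \<Rightarrow> 'a) \<Rightarrow> 'a set" where
  "Stab X \<phi> = {x \<in> X. \<exists>xs :: nat \<Rightarrow> 'a. (\<forall>n. xs n \<in> X) \<and> xs 0 = x \<and> (\<forall>n. \<phi> (xs (Suc n)) = xs n)}"

definition Atrac :: "'a set \<Rightarrow> ('a \<Rightarrow> 'a) \<Rightarrow> 'a set" where
  "Atrac X \<phi> = (\<Inter>n. (\<phi> ^^ n) ` X)"


section \<open>Free groups\<close>

text \<open>A letter \<open>(a, True)\<close> stands for the generator \<open>a\<close> and \<open>(a, False)\<close> for its inverse. Elements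
  of the free group are the freely reduced words; the product is concatenation followed by free
  reduction.\<close>

definition flip_letter :: "'a \<times> bool \<Rightarrow> 'a \<times> bool" where
  "flip_letter x = (fst x, \<not> snd x)"

definition freely_reduced :: "('a \<times> bool) list \<Rightarrow> bool" where
  "freely_reduced w \<longleftrightarrow> successively (\<lambda>x y. y \<noteq> flip_letter x) w"

fun cons_reduce :: "'a \<times> bool \<Rightarrow> ('a \<times> bool) list \<Rightarrow> ('a \<times> bool) list" where
  "cons_reduce x [] = [x]"
| "cons_reduce x (y # w) = (if y = flip_letter x then w else x # y # w)"

definition free_group :: "'a set \<Rightarrow> ('a \<times> bool) list monoid" where
  "free_group A =
     \<lparr>carrier = {w \<in> lists (A \<times> UNIV). freely_reduced w}, mult = foldr cons_reduce, one = []\<rparr>"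

lemma flip_flip [simp]: "flip_letter (flip_letter x) = x"
  by (simp add: flip_letter_def)

lemma freely_reduced_Nil [simp]: "freely_reduced []"
  by (simp add: freely_reduced_def)

lemma freely_reduced_Cons_imp: "freely_reduced (x # w) \<Longrightarrow> freely_reduced w"
  by (cases w) (auto simp: freely_reduced_def)

lemma freely_reduced_cons_reduce: "freely_reduced w \<Longrightarrow> freely_reduced (cons_reduce x w)"
  by (cases w) (auto simp: freely_reduced_def successively_Cons)

lemma cons_reduce_flip:
  "freely_reduced w \<Longrightarrow> cons_reduce (flip_letter x) (cons_reduce x w) = w"
proof (cases w)
  case (Cons y v)
  assume "freely_reduced w"
  then show ?thesis using Cons by (cases v) (auto simp: freely_reduced_def)
qed auto

lemma cons_reduce_reduced: "freely_reduced (x # w) \<Longrightarrow> cons_reduce x w = x # w"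
  by (cases w) (auto simp: freely_reduced_def)

lemma freely_reduced_foldr: "freely_reduced v \<Longrightarrow> freely_reduced (foldr cons_reduce u v)"
  by (induction u) (auto intro: freely_reduced_cons_reduce)

lemma foldr_cons_reduce:
  assumes "freely_reduced w"
  shows "foldr cons_reduce (cons_reduce x v) w = cons_reduce x (foldr cons_reduce v w)"
proof (cases v)
  case (Cons y u)
  have "cons_reduce x (cons_reduce (flip_letter x) (foldr cons_reduce u w)) = foldr cons_reduce u w"
    using cons_reduce_flip[of _ "flip_letter x"] freely_reduced_foldr[OF assms] by simp
  then show ?thesis using Cons by auto
qed auto

lemma foldr_cons_reduce_assoc:
  assumes "freely_reduced w"
  shows "foldr cons_reduce (foldr cons_reduce u v) w
    = foldr cons_reduce u (foldr cons_reduce v w)"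
  by (induction u) (auto simp: foldr_cons_reduce assms)

lemma foldr_cons_reduce_Nil: "freely_reduced w \<Longrightarrow> foldr cons_reduce w [] = w"
proof (induction w)
  case (Cons x w)
  then show ?case
    using freely_reduced_Cons_imp[OF Cons.prems] cons_reduce_reduced[OF Cons.prems] by simp
qed simp

lemma cons_reduce_lists:
  "x \<in> B \<Longrightarrow> w \<in> lists B \<Longrightarrow> cons_reduce x w \<in> lists B"
  by (cases w) auto

lemma foldr_cons_reduce_lists:
  "u \<in> lists B \<Longrightarrow> w \<in> lists B \<Longrightarrow> foldr cons_reduce u w \<in> lists B"
proof (induction u)
  case (Cons x u)
  then show ?case using cons_reduce_lists[of x B "foldr cons_reduce u w"] by simp
qed simp

lemma ex_foldr_cons_reduce_inverse:
  assumes "w \<in> lists (A \<times> UNIV)" "freely_reduced w"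
  shows "\<exists>v \<in> lists (A \<times> UNIV). freely_reduced v \<and> foldr cons_reduce v w = []"
  using assms
proof (induction w rule: list.induct)
  case (Cons x w)
  then obtain v where v: "v \<in> lists (A \<times> UNIV)" "freely_reduced v" "foldr cons_reduce v w = []"
    using freely_reduced_Cons_imp[OF Cons.prems(2)] by auto
  let ?v = "foldr cons_reduce v [flip_letter x]"
  have w: "cons_reduce (flip_letter x) (x # w) = w"
    by simp
  have "foldr cons_reduce ?v (x # w) = []"
    using foldr_cons_reduce_assoc[OF Cons.prems(2), of v "[flip_letter x]"] w v by simp
  moreover have "freely_reduced ?v"
    by (rule freely_reduced_foldr) (simp add: freely_reduced_def)
  moreover have "?v \<in> lists (A \<times> UNIV)"
    using Cons.prems(1) v(1) by (intro foldr_cons_reduce_lists) (auto simp: flip_letter_def)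
  ultimately show ?case by blast
qed (auto intro: bexI[of _ "[]"])

lemma group_free_group: "group (free_group A)"
proof (rule groupI)
  fix x y z assume "x \<in> carrier (free_group A)" "y \<in> carrier (free_group A)"
    "z \<in> carrier (free_group A)"
  then show "x \<otimes>\<^bsub>free_group A\<^esub> y \<otimes>\<^bsub>free_group A\<^esub> z
      = x \<otimes>\<^bsub>free_group A\<^esub> (y \<otimes>\<^bsub>free_group A\<^esub> z)"
    by (simp add: free_group_def foldr_cons_reduce_assoc)
next
  fix x y assume "x \<in> carrier (free_group A)" "y \<in> carrier (free_group A)"
  then show "x \<otimes>\<^bsub>free_group A\<^esub> y \<in> carrier (free_group A)"
    using foldr_cons_reduce_lists[of x "A \<times> UNIV" y]
    by (simp add: free_group_def freely_reduced_foldr)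
next
  fix x assume "x \<in> carrier (free_group A)"
  then show "\<exists>y \<in> carrier (free_group A). y \<otimes>\<^bsub>free_group A\<^esub> x = \<one>\<^bsub>free_group A\<^esub>"
    using ex_foldr_cons_reduce_inverse[of x A] by (auto simp: free_group_def)
qed (auto simp: free_group_def)

definition free_gen :: "'a \<Rightarrow> ('a \<times> bool) list" where
  "free_gen a = [(a, True)]"

lemma free_gen_closed: "a \<in> A \<Longrightarrow> free_gen a \<in> carrier (free_group A)"
  by (simp add: free_group_def free_gen_def freely_reduced_def)

lemma inv_free_gen:
  assumes "a \<in> A"
  shows "inv\<^bsub>free_group A\<^esub> (free_gen a) = [(a, False)]"
proof (rule group.inv_equality[OF group_free_group])
  show "[(a, False)] \<otimes>\<^bsub>free_group A\<^esub> free_gen a = \<one>\<^bsub>free_group A\<^esub>"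
    by (simp add: free_group_def free_gen_def flip_letter_def)
  show "[(a, False)] \<in> carrier (free_group A)"
    using assms by (simp add: free_group_def freely_reduced_def)
qed (rule free_gen_closed[OF assms])

text \<open>The universal property of the free group (existence and uniqueness of the extension).\<close>

lemma free_group_extend:
  assumes G: "group G" and f: "f \<in> A \<rightarrow> carrier G"
  shows "\<exists>h \<in> hom (free_group A) G. \<forall>a \<in> A. h (free_gen a) = f a"
proof -
  interpret G: group G by (rule G)
  define g where "g = (\<lambda>x. if snd x then f (fst x) else inv\<^bsub>G\<^esub> (f (fst x)))"
  define h where "h = (\<lambda>w. foldr (\<lambda>x y. g x \<otimes>\<^bsub>G\<^esub> y) w \<one>\<^bsub>G\<^esub>)"
  have g: "g x \<in> carrier G" if "x \<in> A \<times> UNIV" for x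
    using f that by (auto simp: g_def)
  have g_flip: "g (flip_letter x) = inv\<^bsub>G\<^esub> (g x)" if "x \<in> A \<times> UNIV" for x
    using f that G.inv_inv[of "f (fst x)"] by (auto simp: g_def flip_letter_def Pi_iff)
  have h: "h w \<in> carrier G" if "w \<in> lists (A \<times> UNIV)" for w
    using that by (induction w) (auto simp: h_def intro: g)
  have h_cons: "h (cons_reduce x w) = g x \<otimes>\<^bsub>G\<^esub> h w"
    if "x \<in> A \<times> UNIV" "w \<in> lists (A \<times> UNIV)" for x w
  proof (cases w)
    case (Cons y v)
    then have v: "v \<in> lists (A \<times> UNIV)" using that by auto
    have "g x \<otimes>\<^bsub>G\<^esub> (g (flip_letter x) \<otimes>\<^bsub>G\<^esub> h v) = h v"
      using g[OF that(1)] h[OF v] g_flip[OF that(1)] by (simp add: G.m_assoc[symmetric])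
    then show ?thesis using Cons by (auto simp: h_def)
  qed (auto simp: h_def)
  have h_mult: "h (foldr cons_reduce u w) = h u \<otimes>\<^bsub>G\<^esub> h w"
    if "u \<in> lists (A \<times> UNIV)" "w \<in> lists (A \<times> UNIV)" for u w
    using that(1)
  proof (induction u)
    case Nil
    show ?case using h[OF that(2)] by (simp add: h_def)
  next
    case (Cons x u)
    have hxu: "h (x # u) = g x \<otimes>\<^bsub>G\<^esub> h u"
      by (simp add: h_def)
    have x: "x \<in> A \<times> UNIV" and u: "u \<in> lists (A \<times> UNIV)" using Cons by simp_all
    show ?case
      using h_cons[OF x foldr_cons_reduce_lists[OF u that(2)]] Cons.IH hxu g[OF x] h[OF u] h[OF that(2)]
      by (simp add: G.m_assoc)
  qed
  have "h \<in> hom (free_group A) G"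
    by (rule homI) (auto simp: free_group_def intro: h h_mult)
  moreover have "h (free_gen a) = f a" if "a \<in> A" for a
    using f that by (auto simp: h_def g_def free_gen_def Pi_iff)
  ultimately show ?thesis by blast
qed

lemma free_group_hom_unique:
  assumes G: "group G" and h: "h \<in> hom (free_group A) G" and k: "k \<in> hom (free_group A) G"
    and eq: "\<And>a. a \<in> A \<Longrightarrow> h (free_gen a) = k (free_gen a)"
    and w: "w \<in> carrier (free_group A)"
  shows "h w = k w"
proof -
  interpret h: group_hom "free_group A" G h
    using G h by (intro group_hom.intro group_free_group) (simp_all add: group_hom_axioms_def)
  interpret k: group_hom "free_group A" G k
    using G k by (intro group_hom.intro group_free_group) (simp_all add: group_hom_axioms_def)
  have inv_eq: "h [(a, False)] = k [(a, False)]" if "a \<in> A" for a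
    using h.hom_inv[OF free_gen_closed[OF that]] k.hom_inv[OF free_gen_closed[OF that]]
      eq[OF that] inv_free_gen[OF that] by simp
  have single: "h [x] = k [x]" if "x \<in> A \<times> UNIV" for x
    using that eq inv_eq by (cases x; cases "snd x") (auto simp: free_gen_def)
  have "w \<in> lists (A \<times> UNIV) \<Longrightarrow> freely_reduced w \<Longrightarrow> h w = k w"
  proof (induction w)
    case Nil
    show ?case using h.hom_one k.hom_one by (simp add: free_group_def)
  next
    case (Cons x w)
    have x: "[x] \<in> carrier (free_group A)" and wc: "w \<in> carrier (free_group A)"
      using Cons.prems by (auto simp: free_group_def freely_reduced_def successively_Cons)
    have "x # w = [x] \<otimes>\<^bsub>free_group A\<^esub> w"
      using Cons.prems by (simp add: free_group_def cons_reduce_reduced)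
    moreover have "h w = k w" "h [x] = k [x]"
      using Cons.IH Cons.prems freely_reduced_Cons_imp[OF Cons.prems(2)] single[of x] by simp_all
    ultimately show ?case
      using h.hom_mult[OF x wc] k.hom_mult[OF x wc] by simp
  qed
  then show ?thesis using w by (simp add: free_group_def)
qed

abbreviation free_group_rank :: "nat \<Rightarrow> (nat \<times> bool) list monoid" where
  "free_group_rank n \<equiv> free_group {..<n}"


section \<open>The space of marked groups and limit groups\<close>

text \<open>The point of \<open>{0,1}\<close> to the power \<open>F\<^sub>n\<close> determined by a subset of \<open>F\<^sub>n\<close>; its coordinates are
  indexed by the elements of \<open>F\<^sub>n\<close>, so it is an extensional function on the carrier.\<close>

definition subset_point :: "nat \<Rightarrow> (nat \<times> bool) list set \<Rightarrow> (nat \<times> bool) list \<Rightarrow> bool" where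
  "subset_point n N = (\<lambda>w \<in> carrier (free_group_rank n). w \<in> N)"

definition marking_point ::
  "nat \<Rightarrow> ('g, 'h) monoid_scheme \<Rightarrow> ((nat \<times> bool) list \<Rightarrow> 'g) \<Rightarrow> (nat \<times> bool) list \<Rightarrow> bool" where
  "marking_point n G p = subset_point n (kernel (free_group_rank n) G p)"

text \<open>Identifying a marked group with its kernel, the set of all marked groups of rank \<open>n\<close> is the
  set of normal subgroups of \<open>F\<^sub>n\<close>: kernels are normal, and a normal subgroup \<open>N\<close> is the kernel of
  the projection onto \<open>F\<^sub>n\<close> modulo \<open>N\<close> (lemmas below).\<close>

definition marked_groups :: "nat \<Rightarrow> ((nat \<times> bool) list \<Rightarrow> bool) set" where
  "marked_groups n = subset_point n ` {N. N \<lhd> free_group_rank n}"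

definition marked_topology :: "nat \<Rightarrow> ((nat \<times> bool) list \<Rightarrow> bool) topology" where
  "marked_topology n = subtopology
     (product_topology (\<lambda>_. discrete_topology (UNIV :: bool set)) (carrier (free_group_rank n)))
     (marked_groups n)"

definition free_markings :: "nat \<Rightarrow> ((nat \<times> bool) list \<Rightarrow> bool) set" where
  "free_markings n =
     {marking_point n (free_group_rank m) q | m q. q \<in> epi (free_group_rank n) (free_group_rank m)}"

definition limit_group :: "('g, 'h) monoid_scheme \<Rightarrow> bool" where
  "limit_group G \<longleftrightarrow> group G \<and>
     (\<exists>n>0. \<exists>p \<in> epi (free_group_rank n) G.
        marking_point n G p \<in> marked_topology n closure_of free_markings n)"

lemma marking_point_in_marked_groups:
  assumes "group G" "p \<in> epi (free_group_rank n) G"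
  shows "marking_point n G p \<in> marked_groups n"
proof -
  interpret group_hom "free_group_rank n" G p
    using assms by (intro group_hom.intro group_free_group)
      (simp_all add: group_hom_axioms_def epi_def)
  show ?thesis unfolding marking_point_def marked_groups_def using normal_kernel by blast
qed

lemma marked_groups_eq_kernels:
  "marked_groups n =
     {marking_point n (G :: (nat \<times> bool) list set monoid) p | G p.
        group G \<and> p \<in> epi (free_group_rank n) G}" (is "?L = ?R")
proof
  show "?R \<subseteq> ?L" using marking_point_in_marked_groups by blast
  show "?L \<subseteq> ?R"
  proof
    fix P assume "P \<in> ?L"
    then obtain N where N: "N \<lhd> free_group_rank n" and P: "P = subset_point n N"
      by (auto simp: marked_groups_def)
    let ?F = "free_group_rank n"
    interpret normal N ?F by (rule N)
    let ?p = "\<lambda>x. N #>\<^bsub>?F\<^esub> x"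
    have "group (?F Mod N)" by (rule factorgroup_is_group)
    moreover have "?p \<in> epi ?F (?F Mod N)"
      using r_coset_hom_Mod by (auto simp: epi_def FactGroup_def RCOSETS_def)
    moreover have "kernel ?F (?F Mod N) ?p = N"
      using coset_join1[OF _ _ subgroup_axioms] coset_join2[OF _ subgroup_axioms] subset
      by (auto simp: kernel_def FactGroup_def)
    ultimately show "P \<in> ?R"
      unfolding P marking_point_def by (intro CollectI exI[of _ "?F Mod N"] exI[of _ ?p]) auto
  qed
qed


section \<open>Substitutions\<close>

text \<open>A substitution on an alphabet \<open>S\<close> is a function with \<open>\<sigma> \<in> S \<rightarrow> lists S\<close>.\<close>

definition subst_star :: "('s \<Rightarrow> 's list) \<Rightarrow> 's list \<Rightarrow> 's list" where
  "subst_star \<sigma> w = concat (map \<sigma> w)"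

definition mortal :: "('s \<Rightarrow> 's list) \<Rightarrow> 's \<Rightarrow> bool" where
  "mortal \<sigma> s \<longleftrightarrow> (\<exists>n\<ge>1. (subst_star \<sigma> ^^ n) [s] = [])"

abbreviation immortal :: "('s \<Rightarrow> 's list) \<Rightarrow> 's \<Rightarrow> bool" where
  "immortal \<sigma> s \<equiv> \<not> mortal \<sigma> s"

definition non_erasing :: "'s set \<Rightarrow> ('s \<Rightarrow> 's list) \<Rightarrow> bool" where
  "non_erasing S \<sigma> \<longleftrightarrow> (\<forall>s \<in> S. immortal \<sigma> s)"

definition omega_words :: "'s set \<Rightarrow> ('s \<Rightarrow> 's list) \<Rightarrow> 's stream set" where
  "omega_words S \<sigma> = {w \<in> streams S. infinite {n. immortal \<sigma> (w !! n)}}"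

text \<open>\<^const>\<open>flat\<close> concatenates a stream of nonempty words, so the empty words
  \<open>\<sigma>(s\<^sub>i) = \<epsilon>\<close> are dropped first. On \<^const>\<open>omega_words\<close> infinitely many nonempty words
  remain. Lemma \<open>subst_omega_prefix\<close> confirms that the result is
  \<open>\<sigma>(s\<^sub>1) \<sigma>(s\<^sub>2) \<dots>\<close>.\<close>

definition subst_omega :: "('s \<Rightarrow> 's list) \<Rightarrow> 's stream \<Rightarrow> 's stream" where
  "subst_omega \<sigma> w = flat (sfilter (\<lambda>u. u \<noteq> []) (smap \<sigma> w))"

lemma omega_words_non_erasing: "non_erasing S \<sigma> \<Longrightarrow> omega_words S \<sigma> = streams S"
proof -
  assume "non_erasing S \<sigma>"
  then have "{n. immortal \<sigma> (w !! n)} = UNIV" if "w \<in> streams S" for w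
    using that by (auto simp: non_erasing_def streams_iff_snth)
  then show ?thesis by (auto simp: omega_words_def)
qed

lemma subst_star_closed: "\<sigma> \<in> S \<rightarrow> lists S \<Longrightarrow> subst_star \<sigma> \<in> lists S \<rightarrow> lists S"
  by (fastforce simp: subst_star_def)

lemma subst_star_append [simp]: "subst_star \<sigma> (u @ v) = subst_star \<sigma> u @ subst_star \<sigma> v"
  by (simp add: subst_star_def)

lemma subst_omega_SCons: "subst_omega \<sigma> (s ## w) = \<sigma> s @- subst_omega \<sigma> w"
  by (simp add: subst_omega_def smap_ctr sfilter_Stream)

lemma subst_omega_prefix:
  "subst_omega \<sigma> w = subst_star \<sigma> (stake k w) @- subst_omega \<sigma> (sdrop k w)"
proof (induction k arbitrary: w)
  case (Suc k)
  have "subst_omega \<sigma> w = \<sigma> (shd w) @- subst_omega \<sigma> (stl w)"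
    using subst_omega_SCons[of \<sigma> "shd w" "stl w"] by simp
  also have "\<dots> = \<sigma> (shd w) @- (subst_star \<sigma> (stake k (stl w)) @- subst_omega \<sigma> (sdrop k (stl w)))"
    by (subst Suc) (rule refl)
  finally show ?case by (simp add: subst_star_def)
qed (simp add: subst_star_def)

lemma subst_star_funpow_append:
  "(subst_star \<sigma> ^^ n) (u @ v) = (subst_star \<sigma> ^^ n) u @ (subst_star \<sigma> ^^ n) v"
  by (induction n) auto

lemma subst_star_funpow_Nil: "(subst_star \<sigma> ^^ n) [] = []"
  by (induction n) (auto simp: subst_star_def)

lemma immortal_image:
  assumes "immortal \<sigma> s"
  shows "\<exists>t \<in> set (\<sigma> s). immortal \<sigma> t"
proof (rule ccontr)
  assume "\<not> ?thesis"
  moreover have "(\<forall>t \<in> set w. mortal \<sigma> t) \<Longrightarrow> \<exists>n. (subst_star \<sigma> ^^ n) w = []" for w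
  proof (induction w)
    case (Cons t w)
    then obtain m n where m: "(subst_star \<sigma> ^^ m) [t] = []" and n: "(subst_star \<sigma> ^^ n) w = []"
      by (auto simp: mortal_def)
    have "(subst_star \<sigma> ^^ (n + m)) [t] = []" "(subst_star \<sigma> ^^ (m + n)) w = []"
      by (simp_all add: funpow_add m n subst_star_funpow_Nil)
    then have "(subst_star \<sigma> ^^ (n + m)) (t # w) = []"
      using subst_star_funpow_append[of "n + m" \<sigma> "[t]" w] by (simp add: add.commute)
    then show ?case by blast
  qed (auto simp: subst_star_funpow_Nil)
  ultimately obtain n where "(subst_star \<sigma> ^^ n) (\<sigma> s) = []" by blast
  then have "(subst_star \<sigma> ^^ Suc n) [s] = []"
    by (simp add: funpow_Suc_right subst_star_def del: funpow.simps)
  then have "mortal \<sigma> s" unfolding mortal_def by (intro exI[of _ "Suc n"]) auto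
  then show False using assms by simp
qed

lemma infinite_immortal_ge:
  assumes "w \<in> omega_words S \<sigma>"
  shows "\<exists>n\<ge>k. immortal \<sigma> (w !! n)"
  using assms unfolding omega_words_def infinite_nat_iff_unbounded_le by blast

lemma subst_star_stake_unbounded:
  assumes w: "w \<in> omega_words S \<sigma>"
  shows "\<exists>k. m \<le> length (subst_star \<sigma> (stake k w))"
proof (induction m)
  case (Suc m)
  then obtain k where k: "m \<le> length (subst_star \<sigma> (stake k w))" by blast
  obtain n where n: "n \<ge> k" "immortal \<sigma> (w !! n)" using infinite_immortal_ge[OF w] by blast
  have "stake n w = stake k w @ stake (n - k) (sdrop k w)"
    using n(1) by (metis le_add_diff_inverse stake_add)
  moreover have "stake (Suc n) w = stake n w @ [w !! n]" by (rule stake_Suc)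
  moreover have "\<sigma> (w !! n) \<noteq> []" using immortal_image[OF n(2)] by auto
  ultimately have "Suc m \<le> length (subst_star \<sigma> (stake (Suc n) w))"
    using k by (cases "\<sigma> (w !! n)") (simp_all add: subst_star_def del: stake_add stake.simps)
  then show ?case by blast
qed auto

lemma subst_omega_closed:
  assumes \<sigma>: "\<sigma> \<in> S \<rightarrow> lists S"
  shows "subst_omega \<sigma> \<in> omega_words S \<sigma> \<rightarrow> omega_words S \<sigma>"
proof
  fix w assume w: "w \<in> omega_words S \<sigma>"
  have wS: "w !! i \<in> S" for i using w by (auto simp: omega_words_def streams_iff_snth)
  have "subst_omega \<sigma> w !! m \<in> S" for m
  proof -
    obtain k where k: "Suc m \<le> length (subst_star \<sigma> (stake k w))"
      using subst_star_stake_unbounded[OF w] by blast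
    have "stake k w \<in> lists S"
      using wS by (auto simp: in_set_conv_nth)
    then have "subst_star \<sigma> (stake k w) \<in> lists S" using subst_star_closed[OF \<sigma>] by auto
    moreover have "subst_omega \<sigma> w !! m = subst_star \<sigma> (stake k w) ! m"
      using k by (subst subst_omega_prefix[of _ _ k]) simp
    ultimately show ?thesis using k by (metis Suc_le_lessD in_listsD nth_mem)
  qed
  then have "subst_omega \<sigma> w \<in> streams S" by (simp add: streams_iff_snth)
  moreover have "\<exists>n\<ge>m. immortal \<sigma> (subst_omega \<sigma> w !! n)" for m
  proof -
    obtain k where k: "m \<le> length (subst_star \<sigma> (stake k w))"
      using subst_star_stake_unbounded[OF w] by blast
    obtain n where n: "n \<ge> k" "immortal \<sigma> (w !! n)" using infinite_immortal_ge[OF w] by blast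
    obtain i where i: "i < length (\<sigma> (w !! n))" "immortal \<sigma> (\<sigma> (w !! n) ! i)"
      using immortal_image[OF n(2)] by (auto simp: in_set_conv_nth)
    let ?l = "length (subst_star \<sigma> (stake n w))"
    have "stake n w = stake k w @ stake (n - k) (sdrop k w)"
      using n(1) by (metis le_add_diff_inverse stake_add)
    then have "m \<le> ?l" using k by (simp del: stake_add)
    moreover have "subst_star \<sigma> (stake (Suc n) w) = subst_star \<sigma> (stake n w) @ \<sigma> (w !! n)"
      by (simp only: stake_Suc subst_star_append) (simp add: subst_star_def)
    then have "subst_omega \<sigma> w !! (?l + i) = \<sigma> (w !! n) ! i"
      using i(1) by (subst subst_omega_prefix[of _ _ "Suc n"]) (simp del: stake.simps)
    ultimately show ?thesis using i(2) by (intro exI[of _ "?l + i"]) auto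
  qed
  ultimately show "subst_omega \<sigma> w \<in> omega_words S \<sigma>"
    unfolding omega_words_def infinite_nat_iff_unbounded_le by auto
qed

end

theory Submission
  imports Defs "HOL-Library.Function_Algebras" "HOL-Computational_Algebra.Polynomial"
begin

text \<open>
  \<open>Atrac \<phi>\<close> equals \<open>Stab \<phi>\<close> as soon as every point \<open>x\<close> of \<open>Atrac \<phi>\<close> has a preimage in \<open>Atrac \<phi>\<close>.
  For a compact space it does because the sets \<open>\<phi>\<^sup>n(X) \<inter> \<phi>\<^sup>-\<^sup>1(x)\<close> are nested, nonempty and closed.

  For a limit group \<open>G\<close> the kernels of \<open>\<phi>\<^sup>k\<close> stabilize, so \<open>\<phi>\<close> is injective on some \<open>\<phi>\<^sup>K(G)\<close>.
  Otherwise choose \<open>g\<^sub>k\<close> in the kernel of \<open>\<phi>\<^sup>k\<^sup>+\<^sup>1\<close> but not of \<open>\<phi>\<^sup>k\<close>, and words \<open>w\<^sub>k\<close> representing them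
  in \<open>F\<^sub>n\<close>. With \<open>\<Phi>\<close> a lift of \<open>\<phi>\<close> to \<open>F\<^sub>n\<close> and \<open>q\<close> a marking of a free group close to that of
  \<open>G\<close>, the homomorphism \<open>q \<circ> \<Phi>\<^sup>K\<close> kills \<open>w\<^sub>0, \<dots>, w\<^sub>K\<^sub>-\<^sub>1\<close> but not \<open>w\<^sub>K\<close>. For some \<open>K\<close> this is
  impossible: free groups act faithfully on the plane by matrices, so that \<open>q(w) = 1\<close> becomes a
  polynomial equation in the entries of the matrices of \<open>q\<close>, and Hilbert's basis theorem applies.

  For a substitution, \<open>\<sigma>\<^sup>N\<close> erases all mortal letters for some \<open>N\<close>, so that only words over the
  immortal letters matter; there are finitely many candidates of these for finite words, and a
  diagonal argument applies for infinite ones.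
\<close>

section \<open>Attracting sets and compactness\<close>

lemma funpow_image_antimono:
  assumes "\<phi> \<in> X \<rightarrow> X" "m \<le> n"
  shows "(\<phi> ^^ n) ` X \<subseteq> (\<phi> ^^ m) ` X"
proof -
  have "(\<phi> ^^ k) x \<in> X" if "x \<in> X" for k x
    using that assms(1) by (induction k) auto
  moreover have "(\<phi> ^^ n) x = (\<phi> ^^ m) ((\<phi> ^^ (n - m)) x)" for x
    using assms(2) by (metis comp_apply funpow_add le_add_diff_inverse)
  ultimately show ?thesis by auto
qed

lemma Stab_subset_Atrac: "Stab X \<phi> \<subseteq> Atrac X \<phi>"
proof
  fix x assume "x \<in> Stab X \<phi>"
  then obtain xs where xs: "\<And>n. xs n \<in> X" "xs 0 = x" "\<And>n. \<phi> (xs (Suc n)) = xs n"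
    unfolding Stab_def by auto
  have "(\<phi> ^^ n) (xs n) = x" for n
    by (induction n) (simp_all add: xs funpow_swap1)
  then have "x \<in> (\<phi> ^^ n) ` X" for n using xs(1) by (metis imageI)
  then show "x \<in> Atrac X \<phi>" unfolding Atrac_def by blast
qed

lemma Stab_eq_AtracI:
  assumes "\<And>x. x \<in> Atrac X \<phi> \<Longrightarrow> \<exists>y \<in> Atrac X \<phi>. \<phi> y = x"
  shows "Stab X \<phi> = Atrac X \<phi>"
proof (rule equalityI[OF Stab_subset_Atrac], rule subsetI)
  fix x assume x: "x \<in> Atrac X \<phi>"
  \<comment> \<open>The conjunct with \<open>n = 0\<close> fixes the start of the chain at
    \<open>x\<close>; dependent choice then picks preimages that stay in
    \<open>Atrac X \<phi>\<close>.\<close>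
  obtain xs where "\<And>n. xs n \<in> Atrac X \<phi> \<and> (n = 0 \<longrightarrow> xs n = x)" "\<And>n. \<phi> (xs (Suc n)) = xs n"
    using dependent_nat_choice[where P = "\<lambda>n y. y \<in> Atrac X \<phi> \<and> (n = 0 \<longrightarrow> y = x)" and Q = "\<lambda>n y z. \<phi> z = y"]
      x assms by (metis nat.distinct(1))
  moreover have "Atrac X \<phi> \<subseteq> X"
    unfolding Atrac_def using INF_lower[of 0 UNIV "\<lambda>n. (\<phi> ^^ n) ` X"] by simp
  ultimately show "x \<in> Stab X \<phi>"
    unfolding Stab_def by (intro CollectI conjI exI[of _ xs]) (use x in auto)
qed

lemma Stab_eq_Atrac_compact:
  assumes compact: "compact_space T" and T: "Hausdorff_space T" and f: "continuous_map T T f"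
  shows "Stab (topspace T) f = Atrac (topspace T) f"
proof (rule Stab_eq_AtracI)
  let ?X = "topspace T"
  fix x assume x: "x \<in> Atrac ?X f"
  have fX: "f \<in> ?X \<rightarrow> ?X" using f by (simp add: continuous_map_def)
  have xX: "x \<in> ?X" using x by (auto simp: Atrac_def dest: spec[of _ 0])
  have cont: "continuous_map T T (f ^^ n)" for n
    by (induction n) (simp_all add: continuous_map_compose[OF _ f, unfolded comp_def] comp_def flip: id_def)
  define C where "C n = {y \<in> ?X. f y = x} \<inter> (f ^^ n) ` ?X" for n
  have closed: "closedin T (C n)" for n
    unfolding C_def
  proof (intro closedin_Int)
    show "closedin T {y \<in> ?X. f y = x}"
      using closedin_continuous_map_preimage[OF f closedin_Hausdorff_singleton[OF T xX]] by simp
    \<comment> \<open>A continuous image of a compact space is compact, hence closed in a Hausdorff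
      space.\<close>
    show "closedin T ((f ^^ n) ` ?X)"
      using compact T cont by (metis compact_space_def compactin_imp_closedin image_compactin)
  qed
  have nonempty: "C n \<noteq> {}" for n
  proof -
    from x have "x \<in> (f ^^ Suc n) ` ?X" unfolding Atrac_def by blast
    then obtain y where y: "y \<in> ?X" "f ((f ^^ n) y) = x" by auto
    moreover have "(f ^^ n) y \<in> ?X" using cont[of n] y(1) by (auto simp: continuous_map_def)
    ultimately show ?thesis unfolding C_def by blast
  qed
  have decr: "C n \<subseteq> C m" if "m \<le> n" for m n
    using funpow_image_antimono[OF fX that] unfolding C_def by blast
  have "(\<Inter>n. C n) \<noteq> {}"
    by (rule compact_space_imp_nest[OF compact closed nonempty])
       (use decr in \<open>auto simp: monotone_def decseq_def\<close>)
  then show "\<exists>y \<in> Atrac ?X f. f y = x"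
    unfolding C_def Atrac_def by blast
qed

section \<open>Hilbert's basis theorem\<close>

definition subring_set :: "'r::comm_ring_1 set \<Rightarrow> bool" where
  "subring_set A \<longleftrightarrow> 1 \<in> A \<and> (\<forall>a \<in> A. \<forall>b \<in> A. a - b \<in> A \<and> a * b \<in> A)"

text \<open>For a subring \<open>A\<close> this is the \<open>A\<close>-submodule spanned by the
  first \<open>k\<close> terms of \<open>f\<close>, an ideal of \<open>A\<close> when those terms
  lie in \<open>A\<close>.\<close>

definition prefix_span :: "'r::comm_ring_1 set \<Rightarrow> (nat \<Rightarrow> 'r) \<Rightarrow> nat \<Rightarrow> 'r set" where
  "prefix_span A f k = {\<Sum>i<k. a i * f i | a. \<forall>i. a i \<in> A}"

text \<open>The ascending chain condition in terms of sequences. The form with one index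
  \<open>k\<close> later yields a single equation implied by the preceding ones.\<close>

definition noetherian_set :: "'r::comm_ring_1 set \<Rightarrow> bool" where
  "noetherian_set A \<longleftrightarrow> (\<forall>f. range f \<subseteq> A \<longrightarrow> (\<exists>k. f k \<in> prefix_span A f k))"

text \<open>The ring \<open>A[x]\<close> for an element \<open>x\<close> of the ambient ring instead
  of an indeterminate, so that coordinate functions can be adjoined directly.\<close>

definition adjoin :: "'r::comm_ring_1 set \<Rightarrow> 'r \<Rightarrow> 'r set" where
  "adjoin A x = {poly p x | p. range (coeff p) \<subseteq> A}"

lemma subring_setD:
  assumes "subring_set A"
  shows "0 \<in> A" "1 \<in> A" "\<And>a b. a \<in> A \<Longrightarrow> b \<in> A \<Longrightarrow> a + b \<in> A"
    "\<And>a b. a \<in> A \<Longrightarrow> b \<in> A \<Longrightarrow> a - b \<in> A" "\<And>a b. a \<in> A \<Longrightarrow> b \<in> A \<Longrightarrow> a * b \<in> A"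
proof -
  show 0: "0 \<in> A" using assms unfolding subring_set_def by (metis diff_self)
  show "a + b \<in> A" if "a \<in> A" "b \<in> A" for a b
    using assms 0 that unfolding subring_set_def by (metis diff_0 diff_minus_eq_add)
qed (use assms in \<open>auto simp: subring_set_def\<close>)

lemma subring_set_sum:
  assumes "subring_set A" "\<And>i. i \<in> I \<Longrightarrow> f i \<in> A"
  shows "sum f I \<in> A"
  using assms(2) by (induction I rule: infinite_finite_induct) (auto intro: subring_setD[OF assms(1)])

lemma prefix_span_base:
  assumes "subring_set A" "i < k"
  shows "f i \<in> prefix_span A f k"
proof -
  have "f i = (\<Sum>j<k. (if j = i then 1 else 0) * f j)"
    using assms(2) by (simp add: if_distrib[of "\<lambda>x. x * _"] sum.delta' cong: if_cong)
  then show ?thesis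
    unfolding prefix_span_def using subring_setD(1,2)[OF assms(1)]
    by (intro CollectI exI[of _ "\<lambda>j. if j = i then 1 else 0"]) auto
qed

lemma prefix_span_closed:
  assumes A: "subring_set A"
  shows "0 \<in> prefix_span A f k"
    and "u \<in> prefix_span A f k \<Longrightarrow> v \<in> prefix_span A f k \<Longrightarrow> u + v \<in> prefix_span A f k"
    and "u \<in> prefix_span A f k \<Longrightarrow> v \<in> prefix_span A f k \<Longrightarrow> u - v \<in> prefix_span A f k"
    and "c \<in> A \<Longrightarrow> u \<in> prefix_span A f k \<Longrightarrow> c * u \<in> prefix_span A f k"
proof -
  have "0 = (\<Sum>i<k. 0 * f i)" by simp
  then show "0 \<in> prefix_span A f k"
    unfolding prefix_span_def using subring_setD(1)[OF A] by (intro CollectI exI[of _ "\<lambda>_. 0"]) auto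
next
  assume "u \<in> prefix_span A f k" "v \<in> prefix_span A f k"
  then obtain a b where a: "\<And>i. a i \<in> A" "\<And>i. b i \<in> A"
    and "u = (\<Sum>i<k. a i * f i)" "v = (\<Sum>i<k. b i * f i)"
    unfolding prefix_span_def by auto
  then have "u + v = (\<Sum>i<k. (a i + b i) * f i)" "u - v = (\<Sum>i<k. (a i - b i) * f i)"
    by (simp_all add: algebra_simps sum.distrib sum_subtractf)
  then show "u + v \<in> prefix_span A f k" "u - v \<in> prefix_span A f k"
    unfolding prefix_span_def
    using subring_setD(3,4)[OF A a]
    by (auto intro: exI[of _ "\<lambda>i. a i + b i"] exI[of _ "\<lambda>i. a i - b i"])
next
  assume c: "c \<in> A" and "u \<in> prefix_span A f k"
  then obtain a where a: "\<And>i. a i \<in> A" and "u = (\<Sum>i<k. a i * f i)"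
    unfolding prefix_span_def by auto
  then have "c * u = (\<Sum>i<k. (c * a i) * f i)"
    by (simp add: sum_distrib_left mult.assoc)
  then show "c * u \<in> prefix_span A f k"
    unfolding prefix_span_def
    using subring_setD(5)[OF A c a] by (intro CollectI exI[of _ "\<lambda>i. c * a i"]) auto
qed

lemma prefix_span_sum:
  assumes A: "subring_set A" and "\<And>i. i \<in> I \<Longrightarrow> h i \<in> prefix_span A f k"
  shows "sum h I \<in> prefix_span A f k"
  using assms(2)
  by (induction I rule: infinite_finite_induct) (auto intro: prefix_span_closed[OF A])

lemma prefix_span_mono:
  assumes A: "subring_set A" and "k \<le> l"
  shows "prefix_span A f k \<subseteq> prefix_span A f l"
proof
  fix u assume "u \<in> prefix_span A f k"
  then obtain a where "\<And>i. a i \<in> A" "u = (\<Sum>i<k. a i * f i)"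
    unfolding prefix_span_def by auto
  then show "u \<in> prefix_span A f l"
    using assms(2) by (auto intro!: prefix_span_sum[OF A] prefix_span_closed(4)[OF A] prefix_span_base[OF A])
qed

lemma coeff_mult_in:
  assumes A: "subring_set A" and "range (coeff p) \<subseteq> A" "range (coeff q) \<subseteq> A"
  shows "range (coeff (p * q)) \<subseteq> A"
  using assms(2,3) by (auto simp: coeff_mult intro!: subring_set_sum[OF A] subring_setD(5)[OF A])

lemma coeff_diff_in:
  assumes A: "subring_set A" and "range (coeff p) \<subseteq> A" "range (coeff q) \<subseteq> A"
  shows "range (coeff (p - q)) \<subseteq> A"
  using assms(2,3) by (auto intro!: subring_setD(4)[OF A])

lemma coeff_sum_in:
  assumes A: "subring_set A" and "\<And>i. i \<in> I \<Longrightarrow> range (coeff (p i)) \<subseteq> A"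
  shows "range (coeff (sum p I)) \<subseteq> A"
  using assms(2) by (auto simp: coeff_sum intro!: subring_set_sum[OF A])

lemma coeff_monom_in:
  assumes A: "subring_set A" and "c \<in> A"
  shows "range (coeff (monom c n)) \<subseteq> A"
  using assms(2) subring_setD(1)[OF A] by auto

section \<open>Adjoining elements to a noetherian subring\<close>

lemma adjoin_subring:
  assumes A: "subring_set A"
  shows "subring_set (adjoin A x)"
  unfolding subring_set_def
proof (intro conjI ballI)
  have "poly (monom 1 0) x = 1" by (simp add: poly_monom)
  then show "1 \<in> adjoin A x"
    unfolding adjoin_def using coeff_monom_in[OF A subring_setD(2)[OF A], of 0] by (metis (mono_tags, lifting) CollectI)
  fix a b assume "a \<in> adjoin A x" "b \<in> adjoin A x"
  then obtain p q where "range (coeff p) \<subseteq> A" "range (coeff q) \<subseteq> A" "a = poly p x" "b = poly q x"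
    unfolding adjoin_def by auto
  then show "a - b \<in> adjoin A x" "a * b \<in> adjoin A x"
    unfolding adjoin_def using coeff_mult_in[OF A, of p q] coeff_diff_in[OF A, of p q]
    by (metis (mono_tags, lifting) CollectI poly_diff poly_mult)+
qed

lemma subset_adjoin:
  assumes A: "subring_set A"
  shows "insert x A \<subseteq> adjoin A x"
proof -
  have "c \<in> adjoin A x" if "c \<in> A" for c
    unfolding adjoin_def using coeff_monom_in[OF A that, of 0]
    by (intro CollectI exI[of _ "monom c 0"]) (simp add: poly_monom)
  moreover have "x \<in> adjoin A x"
    unfolding adjoin_def using coeff_monom_in[OF A subring_setD(2)[OF A], of 1]
    by (intro CollectI exI[of _ "monom 1 1"]) (simp add: poly_monom)
  ultimately show ?thesis by auto
qed

text \<open>Hilbert's basis theorem. Polynomials are only used to represent the elements of \<open>A[x]\<close>; the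
  argument never needs the representation to be unique.\<close>

lemma noetherian_adjoin:
  fixes x :: "'r::comm_ring_1"
  assumes A: "subring_set A" and noeth: "noetherian_set A"
  shows "noetherian_set (adjoin A x)"
proof (rule ccontr)
  let ?B = "adjoin A x"
  assume "\<not> noetherian_set ?B"
  then obtain g where g: "\<And>k. g k \<in> ?B" and bad: "\<And>k. g k \<notin> prefix_span ?B g k"
    unfolding noetherian_set_def by auto
  note B = adjoin_subring[OF A, of x]
  \<comment> \<open>The ideal generated by all \<open>g k\<close>. By \<open>bad\<close> it is not
    finitely generated, which \<open>not_fg\<close> records for arbitrary finite families in
    \<open>I\<close>.\<close>
  define I where "I = (\<Union>k. prefix_span ?B g k)"
  have I_diff: "u - v \<in> I" if uI: "u \<in> I" and vI: "v \<in> I" for u v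
  proof -
    obtain k l where "u \<in> prefix_span ?B g k" "v \<in> prefix_span ?B g l"
      using uI vI unfolding I_def by blast
    then have "u \<in> prefix_span ?B g (max k l)" "v \<in> prefix_span ?B g (max k l)"
      using prefix_span_mono[OF B] by (meson max.cobounded1 max.cobounded2 subsetD)+
    then show ?thesis
      unfolding I_def using prefix_span_closed(3)[OF B] by blast
  qed
  have I_mult: "c * u \<in> I" if "c \<in> ?B" "u \<in> I" for c u
    using that prefix_span_closed(4)[OF B] unfolding I_def by blast
  have I_0: "0 \<in> I"
    using prefix_span_closed(1)[OF B] unfolding I_def by blast
  have I_sum: "sum h J \<in> I" if "\<And>i. i \<in> J \<Longrightarrow> h i \<in> I" for h :: "nat \<Rightarrow> 'r" and J
    using that
  proof (induction J rule: infinite_finite_induct)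
    case (insert j J)
    have "h j - (0 - sum h J) \<in> I" using insert I_0 by (intro I_diff) auto
    then show ?case using insert by simp
  qed (use I_0 in auto)
  have not_fg: "\<exists>u \<in> I. u \<notin> prefix_span ?B f k" if f: "\<And>i. i < k \<Longrightarrow> f i \<in> I" for f k
  proof -
    have "\<exists>m. \<forall>i<k. f i \<in> prefix_span ?B g m" using f
    proof (induction k)
      case (Suc k)
      then obtain m where m: "\<forall>i<k. f i \<in> prefix_span ?B g m" by auto
      obtain l where "f k \<in> prefix_span ?B g l" using Suc.prems unfolding I_def by blast
      then have "\<forall>i<Suc k. f i \<in> prefix_span ?B g (max m l)"
        using m prefix_span_mono[OF B] by (metis less_Suc_eq max.cobounded1 max.cobounded2 subsetD)
      then show ?case by blast
    qed auto
    then obtain m where m: "\<forall>i<k. f i \<in> prefix_span ?B g m" by blast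
    have "prefix_span ?B f k \<subseteq> prefix_span ?B g m"
    proof
      fix u assume "u \<in> prefix_span ?B f k"
      then obtain b where "\<And>i. b i \<in> ?B" "u = (\<Sum>i<k. b i * f i)"
        unfolding prefix_span_def by auto
      then show "u \<in> prefix_span ?B g m"
        using m by (auto intro!: prefix_span_sum[OF B] prefix_span_closed(4)[OF B])
    qed
    moreover have "g m \<in> I" unfolding I_def using prefix_span_base[OF B lessI] by blast
    ultimately show ?thesis using bad[of m] by blast
  qed
  define cand where "cand f k = {p. range (coeff p) \<subseteq> A \<and> poly p x \<in> I \<and>
      poly p x \<notin> prefix_span ?B (\<lambda>i. poly (f i) x) k}" for f :: "nat \<Rightarrow> 'r poly" and k
  \<comment> \<open>As in the classical proof, \<open>p k\<close> has least degree among the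
    polynomials whose value lies in \<open>I\<close> but outside the span of the values chosen
    before. The degrees are then nondecreasing.\<close>
  define P where "P f k p \<longleftrightarrow> p \<in> cand f k \<and> (\<forall>q \<in> cand f k. degree p \<le> degree q)" for f k p
  have "\<exists>f. \<forall>k. P f k (f k)"
  proof (rule dependent_wf_choice[OF wf])
    fix f f' :: "nat \<Rightarrow> 'r poly" and k p
    assume "\<And>i. (i, k) \<in> {(i, j). i < j} \<Longrightarrow> f i = f' i"
    then have "prefix_span ?B (\<lambda>i. poly (f i) x) k = prefix_span ?B (\<lambda>i. poly (f' i) x) k"
      unfolding prefix_span_def by simp
    then show "P f k p = P f' k p" unfolding P_def cand_def by simp
  next
    fix k and f :: "nat \<Rightarrow> 'r poly"
    assume "\<And>i. (i, k) \<in> {(i, j). i < j} \<Longrightarrow> P f i (f i)"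
    then have "poly (f i) x \<in> I" if "i < k" for i using that unfolding P_def cand_def by blast
    then obtain u where u: "u \<in> I" "u \<notin> prefix_span ?B (\<lambda>i. poly (f i) x) k"
      using not_fg[where f = "\<lambda>i. poly (f i) x" and k = k] by blast
    obtain l b where "\<And>i. b i \<in> ?B" "u = (\<Sum>i<l. b i * g i)"
      using u(1) unfolding I_def prefix_span_def by blast
    then have "u \<in> ?B"
      using g by (auto intro!: subring_set_sum[OF B] subring_setD(5)[OF B])
    then have "\<exists>p. p \<in> cand f k" using u unfolding cand_def adjoin_def by blast
    then obtain p where "is_arg_min degree (\<lambda>p. p \<in> cand f k) p"
      using ex_has_least_nat[of "\<lambda>p. p \<in> cand f k" _ degree] unfolding is_arg_min_linorder by blast
    then show "\<exists>p. P f k p" unfolding P_def is_arg_min_linorder by blast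
  qed
  then obtain p where p: "\<And>k. p k \<in> cand p k" and least: "\<And>k q. q \<in> cand p k \<Longrightarrow> degree (p k) \<le> degree q"
    unfolding P_def by auto
  let ?f = "\<lambda>i. poly (p i) x"
  have cand_antimono: "cand p l \<subseteq> cand p k" if "k \<le> l" for k l
    using prefix_span_mono[OF B that, of ?f] unfolding cand_def by auto
  have degree_mono: "degree (p k) \<le> degree (p l)" if "k \<le> l" for k l
    using least p cand_antimono[OF that] by blast
  have coeffs: "range (coeff (p k)) \<subseteq> A" and pI: "?f k \<in> I"
    and p_not: "?f k \<notin> prefix_span ?B ?f k" for k
    using p[of k] unfolding cand_def by auto
  obtain K where "lead_coeff (p K) \<in> prefix_span A (\<lambda>i. lead_coeff (p i)) K"
    using noeth[unfolded noetherian_set_def, rule_format, of "\<lambda>i. lead_coeff (p i)"] coeffs by blast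
  then obtain a where a: "\<And>i. a i \<in> A" and lead: "lead_coeff (p K) = (\<Sum>i<K. a i * lead_coeff (p i))"
    unfolding prefix_span_def by auto
  \<comment> \<open>The monomials lift the leading terms of the earlier \<open>p i\<close> to the
    degree of \<open>p K\<close>, so that subtracting \<open>s\<close> cancels the leading
    coefficient of \<open>p K\<close>. By \<open>degree_mono\<close> the difference of degrees is
    not truncated.\<close>
  define m where "m i = monom (a i) (degree (p K) - degree (p i))" for i
  define s where "s = (\<Sum>i<K. m i * p i)"
  define r where "r = p K - s"
  have m_coeffs: "range (coeff (m i)) \<subseteq> A" for i unfolding m_def by (rule coeff_monom_in[OF A a])
  have mB: "poly (m i) x \<in> ?B" for i using m_coeffs unfolding adjoin_def by blast
  have poly_s: "poly s x = (\<Sum>i<K. poly (m i) x * ?f i)"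
    unfolding s_def by (simp add: poly_sum)
  then have s_span: "poly s x \<in> prefix_span ?B ?f K"
    using mB unfolding prefix_span_def by (intro CollectI exI[of _ "\<lambda>i. poly (m i) x"]) simp
  have "poly r x \<in> I"
    unfolding r_def by (simp add: poly_s pI I_diff I_sum I_mult mB)
  moreover have "poly r x \<notin> prefix_span ?B ?f K"
  proof
    assume "poly r x \<in> prefix_span ?B ?f K"
    then have "poly r x + poly s x \<in> prefix_span ?B ?f K" by (rule prefix_span_closed(2)[OF B _ s_span])
    then show False using p_not[of K] by (simp add: r_def)
  qed
  moreover have "range (coeff r) \<subseteq> A"
    unfolding r_def s_def by (intro coeff_diff_in coeff_sum_in coeff_mult_in A coeffs m_coeffs)
  ultimately have "r \<in> cand p K" unfolding cand_def by blast
  \<comment> \<open>Minimality forces \<open>r\<close> to have the degree of \<open>p K\<close>,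
    where its coefficient vanishes. So \<open>r\<close> would be 0, although its value lies outside
    the span.\<close>
  then have deg_r: "degree (p K) \<le> degree r" by (rule least)
  have r0: "r \<noteq> 0"
    using \<open>poly r x \<notin> _\<close> prefix_span_closed(1)[OF B] by auto
  have "coeff (m i * p i) (degree (p K)) = a i * lead_coeff (p i)" if "i < K" for i
    using degree_mono[of i K] that unfolding m_def by (simp add: coeff_monom_mult)
  then have "coeff r (degree (p K)) = 0"
    unfolding r_def s_def using lead by (simp add: coeff_sum)
  moreover have "degree (m i * p i) \<le> degree (p K)" if "i < K" for i
    using degree_mono[of i K] that degree_mult_le[of "m i" "p i"] degree_monom_le[of "a i" "degree (p K) - degree (p i)"]
    unfolding m_def by linarith
  then have "degree r \<le> degree (p K)"
    unfolding r_def s_def by (intro degree_diff_le degree_sum_le) auto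
  ultimately show False
    using deg_r r0 by (metis le_antisym leading_coeff_0_iff)
qed

lemma noetherian_subring_containing:
  fixes A :: "'r::comm_ring_1 set"
  assumes "finite X" "subring_set A" "noetherian_set A"
  shows "\<exists>B. subring_set B \<and> noetherian_set B \<and> A \<union> X \<subseteq> B"
  using assms(1)
proof (induction X)
  case empty
  show ?case using assms(2,3) by auto
next
  case (insert x X)
  then obtain B where B: "subring_set B" "noetherian_set B" "A \<union> X \<subseteq> B" by blast
  then show ?case
    using adjoin_subring[of B x] noetherian_adjoin[of B x] subset_adjoin[of B x]
    by (intro exI[of _ "adjoin B x"]) auto
qed

text \<open>The constant functions form a copy of a field in a ring of functions and serve as the
  base to which coordinate functions are adjoined. A sequence in a field either starts with 0, which
  lies in the zero ideal, or has a second term that is a multiple of the first.\<close>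

lemma noetherian_constants:
  "subring_set (range (\<lambda>c :: 'k::field. \<lambda>_ :: 'p. c))"
  "noetherian_set (range (\<lambda>c :: 'k::field. \<lambda>_ :: 'p. c))"
proof -
  let ?C = "range (\<lambda>c :: 'k. \<lambda>_ :: 'p. c)"
  show sub: "subring_set ?C"
    unfolding subring_set_def one_fun_def fun_diff_def times_fun_def by blast
  show "noetherian_set ?C"
    unfolding noetherian_set_def
  proof (intro allI impI)
    fix f :: "nat \<Rightarrow> 'p \<Rightarrow> 'k" assume "range f \<subseteq> ?C"
    then have "\<forall>i. \<exists>c. f i = (\<lambda>_. c)" by (simp add: image_subset_iff image_iff)
    then obtain c where c: "\<And>i. f i = (\<lambda>_. c i)" by (auto dest: choice)
    show "\<exists>k. f k \<in> prefix_span ?C f k"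
    proof (cases "c 0 = 0")
      case True
      then have "f 0 = 0" by (simp add: c zero_fun_def)
      then show ?thesis using prefix_span_closed(1)[OF sub, of f 0] by metis
    next
      case False
      then have "f 1 = (\<lambda>_. c 1 / c 0) * f 0" by (simp add: c fun_eq_iff)
      moreover have "(\<lambda>_. c 1 / c 0) * f 0 \<in> prefix_span ?C f 1"
        by (rule prefix_span_closed(4)[OF sub _ prefix_span_base[OF sub]]) auto
      ultimately show ?thesis by metis
    qed
  qed
qed

section \<open>Limit groups\<close>

text \<open>The letters receive the distinct even numbers 0, 2, 4, ..., so that the open intervals
  of radius 1 around them are disjoint.\<close>

definition center :: "nat \<times> bool \<Rightarrow> real" where
  "center x = 4 * real (fst x) + (if snd x then 2 else 0)"

text \<open>With \<open>c = center x\<close> and \<open>c' = center (flip_letter x)\<close>, this is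
  the Moebius map sending \<open>z\<close> to \<open>c + 1 / (z - c')\<close> in homogeneous
  coordinates. Exchanging \<open>c\<close> and \<open>c'\<close> inverts it.\<close>

definition letter_map :: "nat \<times> bool \<Rightarrow> real \<times> real \<Rightarrow> real \<times> real" where
  "letter_map x v =
     (center x * fst v + (1 - center x * center (flip_letter x)) * snd v,
      fst v - center (flip_letter x) * snd v)"

definition word_map :: "(nat \<times> bool) list \<Rightarrow> real \<times> real \<Rightarrow> real \<times> real" where
  "word_map w v = foldr letter_map w v"

lemma word_map_simps [simp]: "word_map [] v = v" "word_map (x # w) v = letter_map x (word_map w v)"
  by (simp_all add: word_map_def)

lemma center_separated:
  assumes "x \<noteq> y"
  shows "2 \<le> \<bar>center x - center y\<bar>"
proof -
  define k where "k z = 2 * int (fst z) + (if snd z then 1 else 0)" for z :: "nat \<times> bool"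
  have "k x \<noteq> k y"
    using assms by (cases x; cases y) (auto simp: k_def split: if_splits; presburger)
  then have "1 \<le> \<bar>k x - k y\<bar>" by simp
  then have "1 \<le> \<bar>real_of_int (k x - k y)\<bar>" by linarith
  moreover have "center z = 2 * real_of_int (k z)" for z by (simp add: center_def k_def)
  ultimately show ?thesis by (simp add: abs_if split: if_splits)
qed

lemma letter_map_flip: "letter_map (flip_letter x) (letter_map x v) = v"
  by (simp add: letter_map_def prod_eq_iff algebra_simps)

lemma word_map_cons_reduce: "word_map (cons_reduce x w) v = letter_map x (word_map w v)"
proof (cases w)
  case (Cons y u)
  then show ?thesis using letter_map_flip[of "flip_letter x" "word_map u v"] by simp
qed simp

lemma word_map_mult: "word_map (foldr cons_reduce u w) v = word_map u (word_map w v)"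
  by (induction u) (simp_all add: word_map_cons_reduce)

lemma word_map_linear:
  "word_map w (a * p + b * r, a * q + b * s) =
     (a * fst (word_map w (p, q)) + b * fst (word_map w (r, s)),
      a * snd (word_map w (p, q)) + b * snd (word_map w (r, s)))"
  by (induction w) (simp_all add: letter_map_def algebra_simps)

text \<open>Ping-pong: the letter \<open>x\<close> maps the complement of the interval of radius \<open>1\<close> around
  \<open>center (flip_letter x)\<close> of the projective line into the interval of radius \<open>1\<close> around
  \<open>center x\<close>, and these intervals are disjoint. The starting point is \<open>\<infinity> = [1 : 0]\<close>.\<close>

lemma word_map_ping_pong:
  assumes "freely_reduced (x # w)"
  shows "\<bar>fst (word_map (x # w) (1, 0)) - center x * snd (word_map (x # w) (1, 0))\<bar>
    < \<bar>snd (word_map (x # w) (1, 0))\<bar>"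
  using assms
proof (induction w arbitrary: x)
  case Nil
  then show ?case by (simp add: letter_map_def)
next
  case (Cons y w)
  define p where "p = fst (word_map (y # w) (1, 0))"
  define q where "q = snd (word_map (y # w) (1, 0))"
  have "freely_reduced (y # w)" "y \<noteq> flip_letter x"
    using Cons.prems by (auto simp: freely_reduced_def)
  then have y: "\<bar>p - center y * q\<bar> < \<bar>q\<bar>" and sep: "2 \<le> \<bar>center y - center (flip_letter x)\<bar>"
    unfolding p_def q_def using Cons.IH center_separated by blast+
  \<comment> \<open>In the coordinate \<open>z = p / q\<close>: the point lies within 1 of
    \<open>center y\<close>, hence farther than 1 from
    \<open>center (flip_letter x)\<close>.\<close>
  have "2 * \<bar>q\<bar> \<le> \<bar>(center y - center (flip_letter x)) * q\<bar>"
    unfolding abs_mult using sep by (rule mult_right_mono) simp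
  moreover have "(center y - center (flip_letter x)) * q
      = (p - center (flip_letter x) * q) - (p - center y * q)"
    by (simp add: algebra_simps)
  ultimately have "\<bar>q\<bar> < \<bar>p - center (flip_letter x) * q\<bar>"
    using y by linarith
  moreover have "fst (letter_map x (p, q)) - center x * snd (letter_map x (p, q)) = q"
    by (simp add: letter_map_def algebra_simps)
  moreover have "word_map (x # y # w) (1, 0) = letter_map x (p, q)"
    by (simp add: p_def q_def)
  ultimately show ?case by (simp add: letter_map_def)
qed

text \<open>The strict inequality of the ping-pong argument makes the second coordinate nonzero for
  nonempty reduced words. Thus one scalar equation detects the trivial word.\<close>

lemma word_map_faithful:
  assumes "freely_reduced w"
  shows "snd (word_map w (1, 0)) = 0 \<longleftrightarrow> w = []"
  using assms word_map_ping_pong by (cases w) fastforce+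

text \<open>A point assigns to each letter the four entries of a matrix; \<open>True\<close> and \<open>False\<close> index the
  second and the first row or column.\<close>

type_synonym matrix_point = "(nat \<times> bool) \<times> bool \<times> bool \<Rightarrow> real"

section \<open>Words as polynomial functions of matrix entries\<close>

text \<open>A letter and its inverse have independent matrices here, so both components are
  polynomial in \<open>P\<close>.\<close>

definition eval_word :: "(nat \<times> bool) list \<Rightarrow> matrix_point \<Rightarrow> real \<times> real" where
  "eval_word w P = foldr (\<lambda>x v.
     (P (x, False, False) * fst v + P (x, False, True) * snd v,
      P (x, True, False) * fst v + P (x, True, True) * snd v)) w (1, 0)"

definition hom_point :: "((nat \<times> bool) list \<Rightarrow> (nat \<times> bool) list) \<Rightarrow> matrix_point" where
  "hom_point q = (\<lambda>(x, i, j). (if i then snd else fst) (word_map (q [x]) (if j then (0, 1) else (1, 0))))"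

text \<open>Both sides multiply along the word: \<open>q\<close> is a homomorphism and
  \<open>word_map\<close> acts by linear maps, whose matrices are read off from the two basis
  vectors.\<close>

lemma eval_word_hom_point:
  assumes q: "q \<in> hom (free_group A) (free_group B)" and w: "w \<in> carrier (free_group A)"
  shows "eval_word w (hom_point q) = word_map (q w) (1, 0)"
  using w
proof (induction w)
  case Nil
  have "q \<one>\<^bsub>free_group A\<^esub> = \<one>\<^bsub>free_group B\<^esub>"
    by (rule hom_one[OF q group_free_group group_free_group])
  then show ?case by (simp add: eval_word_def free_group_def)
next
  case (Cons x w)
  have x: "[x] \<in> carrier (free_group A)" and wc: "w \<in> carrier (free_group A)"
    using Cons.prems by (auto simp: free_group_def freely_reduced_def successively_Cons)
  have "x # w = [x] \<otimes>\<^bsub>free_group A\<^esub> w"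
    using Cons.prems by (simp add: free_group_def cons_reduce_reduced)
  then have "q (x # w) = q [x] \<otimes>\<^bsub>free_group B\<^esub> q w"
    using hom_mult[OF q x wc] by simp
  then have "word_map (q (x # w)) (1, 0) = word_map (q [x]) (word_map (q w) (1, 0))"
    by (simp add: free_group_def word_map_mult)
  moreover define v where "v = word_map (q w) (1, 0)"
  have "word_map (q [x]) v =
      (fst (word_map (q [x]) (1, 0)) * fst v + fst (word_map (q [x]) (0, 1)) * snd v,
       snd (word_map (q [x]) (1, 0)) * fst v + snd (word_map (q [x]) (0, 1)) * snd v)"
    using word_map_linear[of "q [x]" "fst v" 1 "snd v" 0 0 1] by (simp add: mult.commute)
  ultimately show ?case
    using Cons.IH[OF wc] by (simp add: eval_word_def hom_point_def flip: v_def)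
qed

lemma eval_word_in_subring:
  assumes B: "subring_set B" and const: "(\<lambda>_. 0) \<in> B" "(\<lambda>_. 1) \<in> B"
    and coord: "\<And>x i j. x \<in> A \<Longrightarrow> (\<lambda>P. P (x, i, j)) \<in> B"
    and w: "w \<in> lists A"
  shows "(\<lambda>P. fst (eval_word w P)) \<in> B \<and> (\<lambda>P. snd (eval_word w P)) \<in> B"
  using w
proof (induction w)
  case Nil
  then show ?case using const by (simp add: eval_word_def)
next
  case (Cons x w)
  have IH: "(\<lambda>P. fst (eval_word w P)) \<in> B" "(\<lambda>P. snd (eval_word w P)) \<in> B" and x: "x \<in> A"
    using Cons by auto
  have "(\<lambda>P. P (x, i, False)) * (\<lambda>P. fst (eval_word w P)) + (\<lambda>P. P (x, i, True)) * (\<lambda>P. snd (eval_word w P)) \<in> B" for i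
    by (intro subring_setD(3,5)[OF B] coord x IH)
  from this[of False] this[of True] show ?case
    by (simp add: eval_word_def plus_fun_def times_fun_def)
qed

text \<open>Killing \<open>w i\<close> means that a polynomial function \<open>f i\<close> vanishes
  at the point of \<open>q\<close>. Some \<open>f K\<close> lies in the ideal generated by the
  earlier ones, so it vanishes at their common zeros; \<open>K\<close> depends only on the functions
  and thus serves all \<open>q\<close> at once.\<close>

lemma free_group_equationally_noetherian:
  fixes A :: "nat set" and w :: "nat \<Rightarrow> (nat \<times> bool) list"
  assumes A: "finite A" and w: "\<And>i. w i \<in> carrier (free_group A)"
  shows "\<exists>K. \<forall>B :: nat set. \<forall>q \<in> hom (free_group A) (free_group B). (\<forall>i<K. q (w i) = []) \<longrightarrow> q (w K) = []"
proof -
  let ?C = "range (\<lambda>c :: real. \<lambda>_ :: matrix_point. c)"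
  let ?X = "(\<lambda>i. \<lambda>P :: matrix_point. P i) ` ((A \<times> UNIV) \<times> UNIV \<times> UNIV)"
  have "finite ?X" using A by (intro finite_imageI finite_cartesian_product) auto
  then obtain R where R: "subring_set R" "noetherian_set R" "?C \<union> ?X \<subseteq> R"
    using noetherian_subring_containing[OF _ noetherian_constants] by blast
  define f where "f i = (\<lambda>P. snd (eval_word (w i) P))" for i
  have "f i \<in> R" for i
  proof -
    have "(\<lambda>P. P (x, j, k)) \<in> R" if "x \<in> A \<times> UNIV" for x j k
    proof -
      have "(\<lambda>P. P (x, j, k)) \<in> ?X"
        by (rule image_eqI[of _ _ "(x, j, k)"]) (use that in auto)
      then show ?thesis using R(3) by (meson Un_subset_iff subsetD)
    qed
    moreover have "(\<lambda>_. c) \<in> R" for c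
      using R(3) by (meson Un_subset_iff rangeI subsetD)
    moreover have "w i \<in> lists (A \<times> UNIV)" using w[of i] by (simp add: free_group_def)
    ultimately show ?thesis
      unfolding f_def using eval_word_in_subring[OF R(1), of "A \<times> UNIV" "w i"] by blast
  qed
  then obtain K where "f K \<in> prefix_span R f K"
    using R(2)[unfolded noetherian_set_def, rule_format, of f] by blast
  then obtain a where K: "f K = (\<Sum>i<K. a i * f i)"
    unfolding prefix_span_def by blast
  have K_apply: "f K P = (\<Sum>i<K. a i P * f i P)" for P
  proof -
    have "(\<Sum>i<k. a i * f i) P = (\<Sum>i<k. a i P * f i P)" for k by (induction k) simp_all
    then show ?thesis unfolding K .
  qed
  have f_iff: "f i (hom_point q) = 0 \<longleftrightarrow> q (w i) = []" if q: "q \<in> hom (free_group A) (free_group B)" for q B i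
  proof -
    have "q (w i) \<in> carrier (free_group B)" using hom_in_carrier[OF q w] .
    then show ?thesis
      unfolding f_def eval_word_hom_point[OF q w]
      by (intro word_map_faithful) (simp add: free_group_def)
  qed
  show ?thesis
  proof (intro exI[of _ K] allI ballI impI)
    fix B :: "nat set" and q assume q: "q \<in> hom (free_group A) (free_group B)" and "\<forall>i<K. q (w i) = []"
    then have "f K (hom_point q) = 0" unfolding K_apply by (intro sum.neutral ballI) (simp add: f_iff[OF q])
    then show "q (w K) = []" using f_iff[OF q] by simp
  qed
qed

section \<open>Approximation of limit groups and kernels of iterates\<close>

lemma one_free_group: "\<one>\<^bsub>free_group A\<^esub> = []"
  by (simp add: free_group_def)

text \<open>The words of \<open>T\<close> prescribe finitely many coordinates and so cut out an open
  neighbourhood of the marking of \<open>G\<close>, which must contain a free marking.\<close>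

lemma limit_group_approximation:
  assumes "limit_group G"
  obtains n p where "group G" "p \<in> epi (free_group_rank n) G"
    "\<And>T. finite T \<Longrightarrow> T \<subseteq> carrier (free_group_rank n) \<Longrightarrow>
       \<exists>m. \<exists>q \<in> hom (free_group_rank n) (free_group_rank m). \<forall>w \<in> T. q w = [] \<longleftrightarrow> p w = \<one>\<^bsub>G\<^esub>"
proof -
  obtain n p where G: "group G" and p: "p \<in> epi (free_group_rank n) G"
    and closure: "marking_point n G p \<in> marked_topology n closure_of free_markings n"
    using assms unfolding limit_group_def by blast
  let ?F = "free_group_rank n"
  have "\<exists>m. \<exists>q \<in> hom ?F (free_group_rank m). \<forall>w \<in> T. q w = [] \<longleftrightarrow> p w = \<one>\<^bsub>G\<^esub>"
    if T: "finite T" "T \<subseteq> carrier ?F" for T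
  proof -
    define V where "V w = (if w \<in> T then {marking_point n G p w} else UNIV)" for w
    let ?U = "PiE (carrier ?F) V"
    have "finite {w \<in> carrier ?F. V w \<noteq> UNIV}"
      by (rule finite_subset[OF _ T(1)]) (auto simp: V_def)
    then have "openin (product_topology (\<lambda>_. discrete_topology (UNIV :: bool set)) (carrier ?F)) ?U"
      by (subst openin_PiE_gen) auto
    then have "openin (marked_topology n) (?U \<inter> marked_groups n)"
      unfolding marked_topology_def by (rule openin_subtopology_Int)
    moreover have "marking_point n G p \<in> ?U"
      by (auto simp: PiE_iff V_def marking_point_def subset_point_def)
    moreover have "marking_point n G p \<in> marked_groups n"
      by (rule marking_point_in_marked_groups[OF G p])
    ultimately obtain y where y: "y \<in> free_markings n" "y \<in> ?U"
      using closure unfolding in_closure_of by blast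
    then obtain m q where q: "q \<in> epi ?F (free_group_rank m)"
      and y_def: "y = marking_point n (free_group_rank m) q"
      unfolding free_markings_def by blast
    have "q w = [] \<longleftrightarrow> p w = \<one>\<^bsub>G\<^esub>" if "w \<in> T" for w
    proof -
      have "y w = marking_point n G p w"
        using y(2) that T(2) by (auto simp: PiE_iff V_def dest!: bspec[of _ _ w])
      then show ?thesis
        using subsetD[OF T(2) that]
        unfolding y_def marking_point_def subset_point_def kernel_def by (simp add: one_free_group)
    qed
    then show ?thesis using q unfolding epi_def by blast
  qed
  then show ?thesis using that G p by blast
qed

lemma hom_funpow:
  assumes "\<phi> \<in> hom G G"
  shows "(\<phi> ^^ n) \<in> hom G G"
proof (induction n)
  case 0
  then show ?case by (simp add: hom_def)
next
  case (Suc n)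
  then show ?case using hom_compose[OF Suc assms] by (simp only: funpow.simps(2))
qed

lemma limit_group_kernels_stabilize:
  assumes G: "limit_group G" and \<phi>: "\<phi> \<in> hom G G"
  shows "\<exists>K. \<forall>g \<in> carrier G. (\<phi> ^^ Suc K) g = \<one>\<^bsub>G\<^esub> \<longrightarrow> (\<phi> ^^ K) g = \<one>\<^bsub>G\<^esub>"
proof (rule ccontr)
  assume "\<not> ?thesis"
  then have "\<forall>k. \<exists>g. g \<in> carrier G \<and> (\<phi> ^^ Suc k) g = \<one>\<^bsub>G\<^esub> \<and> (\<phi> ^^ k) g \<noteq> \<one>\<^bsub>G\<^esub>" by blast
  then obtain g where g: "\<And>k. g k \<in> carrier G" "\<And>k. (\<phi> ^^ Suc k) (g k) = \<one>\<^bsub>G\<^esub>"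
    "\<And>k. (\<phi> ^^ k) (g k) \<noteq> \<one>\<^bsub>G\<^esub>" by metis
  obtain n p where grp: "group G" and p: "p \<in> epi (free_group_rank n) G"
    and approx: "\<And>T. finite T \<Longrightarrow> T \<subseteq> carrier (free_group_rank n) \<Longrightarrow>
       \<exists>m. \<exists>q \<in> hom (free_group_rank n) (free_group_rank m). \<forall>w \<in> T. q w = [] \<longleftrightarrow> p w = \<one>\<^bsub>G\<^esub>"
    using limit_group_approximation[OF G] by metis
  let ?F = "free_group_rank n"
  have p_hom: "p \<in> hom ?F G" and p_surj: "p ` carrier ?F = carrier G"
    using p unfolding epi_def by auto
  \<comment> \<open>To lift \<open>\<phi>\<close> through \<open>p\<close>, preimages of the images
    of the generators are chosen; freeness extends this choice to an endomorphism.\<close>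
  have "\<forall>a. \<exists>u. a < n \<longrightarrow> u \<in> carrier ?F \<and> p u = \<phi> (p (free_gen a))"
  proof
    fix a
    have "\<phi> (p (free_gen a)) \<in> p ` carrier ?F" if "a < n"
      unfolding p_surj using hom_in_carrier[OF \<phi>] hom_in_carrier[OF p_hom] free_gen_closed[of a "{..<n}"] that
      by simp
    then show "\<exists>u. a < n \<longrightarrow> u \<in> carrier ?F \<and> p u = \<phi> (p (free_gen a))" unfolding image_iff by metis
  qed
  then obtain r where r: "\<And>a. a < n \<Longrightarrow> r a \<in> carrier ?F" "\<And>a. a < n \<Longrightarrow> p (r a) = \<phi> (p (free_gen a))" by metis
  then have "r \<in> {..<n} \<rightarrow> carrier ?F" by auto
  then obtain \<Phi> where \<Phi>: "\<Phi> \<in> hom ?F ?F" and \<Phi>_gen: "\<forall>a \<in> {..<n}. \<Phi> (free_gen a) = r a"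
    using free_group_extend[OF group_free_group] by blast
  have lift: "p (\<Phi> w) = \<phi> (p w)" if "w \<in> carrier ?F" for w
  proof -
    have "(p \<circ> \<Phi>) w = (\<phi> \<circ> p) w"
    proof (rule free_group_hom_unique[OF grp _ _ _ that])
      show "p \<circ> \<Phi> \<in> hom ?F G" by (rule hom_compose[OF \<Phi> p_hom])
      show "\<phi> \<circ> p \<in> hom ?F G" by (rule hom_compose[OF p_hom \<phi>])
    qed (use \<Phi>_gen r in auto)
    then show ?thesis by simp
  qed
  have \<Phi>_pow: "(\<Phi> ^^ k) w \<in> carrier ?F" if "w \<in> carrier ?F" for k w
    using hom_in_carrier[OF hom_funpow[OF \<Phi>] that] .
  have lift_pow: "p ((\<Phi> ^^ k) w) = (\<phi> ^^ k) (p w)" if "w \<in> carrier ?F" for k w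
    using that by (induction k) (simp_all add: lift \<Phi>_pow)
  have "\<forall>k. \<exists>w. w \<in> carrier ?F \<and> p w = g k"
    using g(1) p_surj by (metis imageE)
  then obtain w where w: "\<And>k. w k \<in> carrier ?F" "\<And>k. p (w k) = g k" by metis
  \<comment> \<open>\<open>K\<close> comes first and is uniform in \<open>q\<close>; only then is
    \<open>q\<close> chosen, to agree with \<open>p\<close> on the finitely many words
    \<open>(\<Phi> ^^ K) (w i)\<close> with \<open>i \<le> K\<close>.\<close>
  from free_group_equationally_noetherian[of _ w, OF finite_lessThan w(1)] obtain K where K: "\<forall>B :: nat set. \<forall>q \<in> hom ?F (free_group B). (\<forall>i<K. q (w i) = []) \<longrightarrow> q (w K) = []"
    by (elim exE)
  let ?T = "(\<lambda>i. (\<Phi> ^^ K) (w i)) ` {..K}"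
  obtain m q where q: "q \<in> hom ?F (free_group_rank m)"
    and q_iff: "\<And>v. v \<in> ?T \<Longrightarrow> q v = [] \<longleftrightarrow> p v = \<one>\<^bsub>G\<^esub>"
    using approx[of ?T] \<Phi>_pow w(1) by (metis finite_atMost finite_imageI image_subsetI)
  have iff: "(q \<circ> (\<Phi> ^^ K)) (w i) = [] \<longleftrightarrow> (\<phi> ^^ K) (g i) = \<one>\<^bsub>G\<^esub>" if "i \<le> K" for i
    using q_iff[of "(\<Phi> ^^ K) (w i)"] that lift_pow[OF w(1)] w(2) by simp
  \<comment> \<open>For \<open>i < K\<close> the element \<open>g i\<close> dies after
    \<open>Suc i \<le> K\<close> iterations, whereas \<open>g K\<close> survives exactly
    \<open>K\<close> of them.\<close>
  have "(\<phi> ^^ K) (g i) = \<one>\<^bsub>G\<^esub>" if "i < K" for i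
  proof -
    have "(\<phi> ^^ K) (g i) = (\<phi> ^^ (K - Suc i)) ((\<phi> ^^ Suc i) (g i))"
      using that by (metis Suc_leI comp_apply funpow_add le_add_diff_inverse2)
    then show ?thesis
      using g(2) hom_one[OF hom_funpow[OF \<phi>] grp grp] by simp
  qed
  then have "(q \<circ> (\<Phi> ^^ K)) (w K) = []"
    using K[rule_format, OF hom_compose[OF hom_funpow[OF \<Phi>] q]] iff by simp
  then show False using iff[of K] g(3) by simp
qed

text \<open>The condition on \<open>K\<close> makes \<open>\<phi>\<close> injective on the image of
  \<open>\<phi> ^^ K\<close>. A point of the attracting set thus has a single preimage in that
  image, and this preimage has histories of every length.\<close>

lemma Stab_eq_Atrac_hom:
  assumes grp: "group G" and \<phi>: "\<phi> \<in> hom G G"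
    and K: "\<And>g. g \<in> carrier G \<Longrightarrow> (\<phi> ^^ Suc K) g = \<one>\<^bsub>G\<^esub> \<Longrightarrow> (\<phi> ^^ K) g = \<one>\<^bsub>G\<^esub>"
  shows "Stab (carrier G) \<phi> = Atrac (carrier G) \<phi>"
proof (rule Stab_eq_AtracI)
  let ?X = "carrier G"
  interpret group G by (rule grp)
  have pow_hom: "group_hom G G (\<phi> ^^ k)" for k
    using hom_funpow[OF \<phi>] by (intro group_hom.intro grp) (simp add: group_hom_axioms_def)
  have closed: "\<phi> \<in> ?X \<rightarrow> ?X" using \<phi> by (simp add: hom_def)
  have inj: "(\<phi> ^^ K) a = (\<phi> ^^ K) b"
    if "a \<in> ?X" "b \<in> ?X" "(\<phi> ^^ Suc K) a = (\<phi> ^^ Suc K) b" for a b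
  proof -
    interpret h: group_hom G G "\<phi> ^^ K" by (rule pow_hom)
    interpret h': group_hom G G "\<phi> ^^ Suc K" by (rule pow_hom)
    have "(\<phi> ^^ Suc K) (a \<otimes>\<^bsub>G\<^esub> inv\<^bsub>G\<^esub> b) = \<one>\<^bsub>G\<^esub>"
      using that by (simp only: h'.hom_mult h'.hom_inv inv_closed h'.hom_closed r_inv)
    then have "(\<phi> ^^ K) (a \<otimes>\<^bsub>G\<^esub> inv\<^bsub>G\<^esub> b) = \<one>\<^bsub>G\<^esub>" using K that by blast
    then have "(\<phi> ^^ K) a \<otimes>\<^bsub>G\<^esub> inv\<^bsub>G\<^esub> ((\<phi> ^^ K) b) = \<one>\<^bsub>G\<^esub>" using that by simp
    then have "inv\<^bsub>G\<^esub> (inv\<^bsub>G\<^esub> ((\<phi> ^^ K) b)) = (\<phi> ^^ K) a"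
      by (rule inv_equality) (use that in simp_all)
    then show ?thesis using that by simp
  qed
  fix x assume x: "x \<in> Atrac ?X \<phi>"
  have "x \<in> (\<phi> ^^ Suc (K + k)) ` ?X" for k
    using x unfolding Atrac_def by blast
  then have "\<forall>k. \<exists>u. u \<in> ?X \<and> \<phi> ((\<phi> ^^ (K + k)) u) = x"
    unfolding image_iff funpow.simps(2) comp_apply by metis
  then obtain u where u: "\<And>k. u k \<in> ?X" "\<And>k. \<phi> ((\<phi> ^^ (K + k)) (u k)) = x" by metis
  let ?z = "(\<phi> ^^ K) (u 0)"
  have eq: "(\<phi> ^^ (K + k)) (u k) = ?z" for k
  proof -
    have "(\<phi> ^^ k) (u k) \<in> ?X" by (rule group_hom.hom_closed[OF pow_hom u(1)])
    then show ?thesis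
      using inj[of "(\<phi> ^^ k) (u k)" "u 0"] u(1) u(2)[of k] u(2)[of 0] by (simp add: funpow_add)
  qed
  have "?z \<in> (\<phi> ^^ k) ` ?X" for k
  proof -
    have "?z \<in> (\<phi> ^^ (K + k)) ` ?X" using eq[of k] u(1)[of k] by (metis imageI)
    then show ?thesis using funpow_image_antimono[OF closed, of k "K + k"] by auto
  qed
  then show "\<exists>y \<in> Atrac ?X \<phi>. \<phi> y = x"
    unfolding Atrac_def using u(2)[of 0] by (intro bexI[of _ ?z]) auto
qed

section \<open>Substitutions\<close>

text \<open>Koenig's lemma for the rows \<open>h k\<close>: the pigeonhole principle chooses each
  \<open>l n\<close> so that infinitely many rows agree with \<open>l\<close> up to and including
  position \<open>n\<close>. The cutoff at \<open>K n\<close> removes only finitely many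
  rows.\<close>

lemma finite_valued_subsequence_limit:
  fixes h :: "nat \<Rightarrow> nat \<Rightarrow> 'a"
  assumes fin: "\<And>i. finite (V i)" and V: "\<And>i k. k \<ge> K i \<Longrightarrow> h k i \<in> V i"
  shows "\<exists>l. \<forall>n. infinite {k. \<forall>i<n. h k i = l i}"
proof -
  have "\<exists>l. \<forall>n. infinite {k. (\<forall>i<n. h k i = l i) \<and> h k n = l n}"
  proof (rule dependent_wf_choice[OF wf])
    fix l and n :: nat
    assume IH: "\<And>i. (i, n) \<in> {(i, j). i < j} \<Longrightarrow> infinite {k. (\<forall>j<i. h k j = l j) \<and> h k i = l i}"
    have inf: "infinite {k. \<forall>i<n. h k i = l i}"
    proof (cases n)
      case (Suc m)
      have "(\<forall>i<n. h k i = l i) \<longleftrightarrow> (\<forall>i<m. h k i = l i) \<and> h k m = l m" for k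
        unfolding Suc less_Suc_eq by blast
      then show ?thesis using IH[of m] Suc by simp
    qed simp
    let ?J = "{k. \<forall>i<n. h k i = l i} - {..<K n}"
    have "infinite ?J" using inf by simp
    moreover have "finite ((\<lambda>k. h k n) ` ?J)"
      by (rule finite_subset[OF _ fin[of n]]) (auto intro: V)
    ultimately obtain k0 where "infinite {k \<in> ?J. h k n = h k0 n}"
      using pigeonhole_infinite[of ?J "\<lambda>k. h k n"] by blast
    then have "infinite {k. (\<forall>i<n. h k i = l i) \<and> h k n = h k0 n}"
      by (rule contrapos_nn) (auto elim: rev_finite_subset)
    then show "\<exists>r. infinite {k. (\<forall>i<n. h k i = l i) \<and> h k n = r}" by blast
  qed auto
  then obtain l where "\<And>n. infinite {k. (\<forall>i<n. h k i = l i) \<and> h k n = l n}" by blast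
  then have "infinite {k. \<forall>i<n. h k i = l i}" for n
    by (rule contrapos_nn) (auto elim: rev_finite_subset)
  then show ?thesis by blast
qed

section \<open>Powers of a substitution and mortal letters\<close>

text \<open>The power of a substitution is again a substitution, so facts about
  \<open>subst_star\<close> and \<open>subst_omega\<close> apply to it.\<close>

definition subst_pow :: "('s \<Rightarrow> 's list) \<Rightarrow> nat \<Rightarrow> 's \<Rightarrow> 's list" where
  "subst_pow \<sigma> n s = (subst_star \<sigma> ^^ n) [s]"

text \<open>Written as a substitution, the deletion of mortal letters can be composed with powers of
  \<open>\<sigma>\<close>.\<close>

definition drop_mortal :: "('s \<Rightarrow> 's list) \<Rightarrow> 's \<Rightarrow> 's list" where
  "drop_mortal \<sigma> s = (if mortal \<sigma> s then [] else [s])"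

lemma subst_star_Nil [simp]: "subst_star \<sigma> [] = []"
  by (simp add: subst_star_def)

lemma subst_star_Cons: "subst_star \<sigma> (s # w) = \<sigma> s @ subst_star \<sigma> w"
  by (simp add: subst_star_def)

lemma subst_star_nonempty: "t \<in> set w \<Longrightarrow> \<rho> t \<noteq> [] \<Longrightarrow> subst_star \<rho> w \<noteq> []"
  by (auto simp: subst_star_def)

lemma subst_star_comp: "subst_star \<sigma> (subst_star \<rho> w) = subst_star (\<lambda>s. subst_star \<sigma> (\<rho> s)) w"
  by (induction w) (simp_all add: subst_star_Cons)

lemma subst_star_cong: "(\<And>s. s \<in> set w \<Longrightarrow> \<sigma> s = \<rho> s) \<Longrightarrow> subst_star \<sigma> w = subst_star \<rho> w"
  by (induction w) (simp_all add: subst_star_Cons)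

lemma subst_star_subst_pow: "subst_star (subst_pow \<sigma> n) w = (subst_star \<sigma> ^^ n) w"
proof (induction w)
  case (Cons s w)
  then show ?case
    using subst_star_funpow_append[of n \<sigma> "[s]" w] by (simp add: subst_star_Cons subst_pow_def)
qed (simp add: subst_star_funpow_Nil)

lemma subst_star_drop_mortal: "subst_star (drop_mortal \<sigma>) w = filter (immortal \<sigma>) w"
  by (induction w) (simp_all add: subst_star_Cons drop_mortal_def)

lemma subst_pow_in_lists:
  assumes "\<sigma> \<in> S \<rightarrow> lists S" "s \<in> S"
  shows "subst_pow \<sigma> n s \<in> lists S"
  unfolding subst_pow_def
proof (induction n)
  case (Suc n)
  then show ?case using subst_star_closed[OF assms(1)] by (simp add: Pi_iff)
qed (use assms(2) in simp)

lemma mortal_iff_word: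
  "(\<exists>n. (subst_star \<sigma> ^^ n) w = []) \<longleftrightarrow> (\<forall>s \<in> set w. mortal \<sigma> s)"
proof
  assume "\<exists>n. (subst_star \<sigma> ^^ n) w = []"
  then obtain n where n: "(subst_star \<sigma> ^^ n) w = []" by blast
  show "\<forall>s \<in> set w. mortal \<sigma> s"
  proof
    fix s assume "s \<in> set w"
    then have "subst_pow \<sigma> n s = []"
      using n by (induction w) (auto simp: subst_star_subst_pow[symmetric] subst_star_Cons)
    \<comment> \<open>\<open>mortal\<close> asks for a positive exponent, and \<open>n\<close> may
      be 0.\<close>
    then have "(subst_star \<sigma> ^^ Suc n) [s] = []" by (simp add: subst_pow_def)
    then show "mortal \<sigma> s" unfolding mortal_def by (metis le_add1 plus_1_eq_Suc)
  qed
next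
  assume "\<forall>s \<in> set w. mortal \<sigma> s"
  then show "\<exists>n. (subst_star \<sigma> ^^ n) w = []"
  proof (induction w)
    case (Cons s w)
    then obtain m n where mn: "(subst_star \<sigma> ^^ m) [s] = []" "(subst_star \<sigma> ^^ n) w = []"
      by (auto simp: mortal_def)
    \<comment> \<open>An erased word stays erased, so the sum of the two exponents works for both
      parts.\<close>
    have "(subst_star \<sigma> ^^ (n + m)) [s] = []" "(subst_star \<sigma> ^^ (m + n)) w = []"
      by (simp_all add: funpow_add mn subst_star_funpow_Nil)
    then have "(subst_star \<sigma> ^^ (n + m)) ([s] @ w) = []"
      by (simp only: subst_star_funpow_append add.commute[of m n] append_Nil)
    then show ?case by auto
  qed (auto simp: subst_star_funpow_Nil)
qed

lemma mortal_image_iff: "(\<forall>t \<in> set (\<sigma> s). mortal \<sigma> t) \<longleftrightarrow> mortal \<sigma> s"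
proof -
  have "(\<exists>n. (subst_star \<sigma> ^^ n) (\<sigma> s) = []) \<longleftrightarrow> (\<exists>n. (subst_star \<sigma> ^^ Suc n) [s] = [])"
    by (simp only: funpow_Suc_right comp_apply) (simp add: subst_star_def)
  also have "\<dots> \<longleftrightarrow> mortal \<sigma> s"
    unfolding mortal_def by (metis One_nat_def Suc_le_D le_add1 plus_1_eq_Suc)
  finally show ?thesis unfolding mortal_iff_word .
qed

text \<open>Mortal letters produce only mortal letters, so deleting them before applying
  \<open>\<sigma>\<close> changes nothing that survives the deletion afterwards.\<close>

lemma drop_mortal_comp:
  "subst_star (drop_mortal \<sigma>) (subst_star \<sigma> (drop_mortal \<sigma> s)) = subst_star (drop_mortal \<sigma>) (\<sigma> s)"
proof (cases "mortal \<sigma> s")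
  case True
  then show ?thesis
    using mortal_image_iff[of \<sigma> s]
    by (simp add: drop_mortal_def subst_star_drop_mortal filter_empty_conv)
qed (simp add: drop_mortal_def subst_star_Cons)

text \<open>All mortal letters of the finite alphabet are listed in one word; an exponent erasing
  that word erases each of them.\<close>

lemma mortality_exponent:
  assumes "finite S"
  shows "\<exists>N. \<forall>s \<in> S. mortal \<sigma> s \<longrightarrow> subst_pow \<sigma> N s = []"
proof -
  have "\<exists>w. set w = {s \<in> S. mortal \<sigma> s}"
    using assms by (intro finite_list) simp
  then obtain w where w: "set w = {s \<in> S. mortal \<sigma> s}" by blast
  then obtain N where "(subst_star \<sigma> ^^ N) w = []"
    using mortal_iff_word[of \<sigma> w] by auto
  then have "concat (map (subst_pow \<sigma> N) w) = []"
    unfolding subst_star_subst_pow[symmetric] subst_star_def .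
  then show ?thesis using w by auto
qed

lemma subst_pow_drop_mortal:
  assumes "\<forall>s \<in> S. mortal \<sigma> s \<longrightarrow> subst_pow \<sigma> N s = []" "s \<in> S"
  shows "subst_star (subst_pow \<sigma> N) (drop_mortal \<sigma> s) = subst_pow \<sigma> N s"
  using assms by (simp add: drop_mortal_def subst_star_Cons)

section \<open>Finite words\<close>

text \<open>Every immortal letter has an immortal letter in its image, so their number never
  drops.\<close>

lemma length_filter_immortal_le:
  "length (filter (immortal \<sigma>) w) \<le> length (filter (immortal \<sigma>) ((subst_star \<sigma> ^^ n) w))"
proof (induction n)
  case (Suc n)
  have "length (filter (immortal \<sigma>) v) \<le> length (filter (immortal \<sigma>) (subst_star \<sigma> v))" for v
  proof (induction v)
    case (Cons s v)
    have "1 \<le> length (filter (immortal \<sigma>) (\<sigma> s))" if "immortal \<sigma> s"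
      using immortal_image[OF that] by (metis One_nat_def Suc_leI filter_empty_conv length_greater_0_conv)
    then show ?case using Cons by (auto simp: subst_star_Cons)
  qed simp
  then show ?case using Suc by (simp add: order_trans)
qed simp

text \<open>The words \<open>\<sigma>\<^sup>N(u)\<close> occurring in a history of \<open>x\<close> depend only on the immortal letters of \<open>u\<close>,
  and \<open>u\<close> has at most as many of them as \<open>x\<close>. So there are only finitely many.\<close>

lemma Stab_eq_Atrac_subst_star:
  assumes S: "finite S" and \<sigma>: "\<sigma> \<in> S \<rightarrow> lists S"
  shows "Stab (lists S) (subst_star \<sigma>) = Atrac (lists S) (subst_star \<sigma>)"
proof (rule Stab_eq_AtracI)
  let ?f = "subst_star \<sigma>"
  fix x assume x: "x \<in> Atrac (lists S) ?f"
  obtain N where N: "\<forall>s \<in> S. mortal \<sigma> s \<longrightarrow> subst_pow \<sigma> N s = []"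
    using mortality_exponent[OF S] by blast
  define L where "L = length (filter (immortal \<sigma>) x)"
  define Y where "Y = (?f ^^ N) ` {v. set v \<subseteq> S \<and> length v \<le> L}"
  have finY: "finite Y" unfolding Y_def by (intro finite_imageI finite_lists_length_le S)
  have closed: "(?f ^^ n) u \<in> lists S" if "u \<in> lists S" for u n
    using that subst_star_closed[OF \<sigma>] by (induction n) (auto simp: Pi_iff)
  have "\<exists>z \<in> Y. z \<in> (?f ^^ k) ` lists S \<and> ?f z = x" for k
  proof -
    \<comment> \<open>The exponent splits into \<open>k\<close> steps from \<open>u\<close> to
      \<open>?v\<close>, then \<open>N\<close> steps to \<open>?z\<close>, which erase mortal
      letters, and one last step to \<open>x\<close>.\<close>
    from x have "x \<in> (?f ^^ (Suc N + k)) ` lists S" unfolding Atrac_def by blast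
    then obtain u where u: "u \<in> lists S" and xu: "x = (?f ^^ (Suc N + k)) u" by blast
    let ?v = "(?f ^^ k) u"
    let ?z = "(?f ^^ N) ?v"
    have v: "?v \<in> lists S" by (rule closed[OF u])
    have fz: "?f ?z = x" unfolding xu by (simp add: funpow_add)
    have "?z = subst_star (\<lambda>s. subst_star (subst_pow \<sigma> N) (drop_mortal \<sigma> s)) ?v"
      unfolding subst_star_subst_pow[symmetric, of N \<sigma>]
      using v by (intro subst_star_cong subst_pow_drop_mortal[OF N, symmetric]) auto
    also have "\<dots> = subst_star (subst_pow \<sigma> N) (subst_star (drop_mortal \<sigma>) ?v)"
      by (rule subst_star_comp[symmetric])
    also have "\<dots> = (?f ^^ N) (filter (immortal \<sigma>) ?v)"
      by (simp only: subst_star_drop_mortal subst_star_subst_pow)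
    finally have "?z = (?f ^^ N) (filter (immortal \<sigma>) ?v)" .
    moreover have "length (filter (immortal \<sigma>) ?v) \<le> L"
      unfolding L_def using length_filter_immortal_le[of \<sigma> ?v "Suc N"] fz by simp
    ultimately have "?z \<in> Y" unfolding Y_def using v by (auto intro!: imageI)
    moreover have "?z \<in> (?f ^^ k) ` lists S"
    proof -
      have "?z = (?f ^^ k) ((?f ^^ N) u)"
        using fun_cong[OF funpow_add[of N k ?f], of u] fun_cong[OF funpow_add[of k N ?f], of u]
        by (simp add: add.commute)
      then show ?thesis using closed[OF u] by blast
    qed
    ultimately show ?thesis using fz by blast
  qed
  then obtain z where z: "\<And>k. z k \<in> Y" "\<And>k. z k \<in> (?f ^^ k) ` lists S" "\<And>k. ?f (z k) = x" by metis
  \<comment> \<open>A value taken infinitely often lies in images of arbitrarily high iterates,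
    hence in all of them, as the images are nested.\<close>
  obtain k0 where k0: "infinite {k \<in> UNIV. z k = z k0}"
    using pigeonhole_infinite[of UNIV z] finite_subset[OF _ finY, of "range z"] z(1) by auto
  have "z k0 \<in> (?f ^^ n) ` lists S" for n
  proof -
    obtain k where k: "k \<ge> n" "z k = z k0"
      using k0 unfolding infinite_nat_iff_unbounded_le by auto
    then show ?thesis
      using z(2)[of k] funpow_image_antimono[OF subst_star_closed[OF \<sigma>] k(1)] by auto
  qed
  then show "\<exists>y \<in> Atrac (lists S) ?f. ?f y = x"
    using z(3) unfolding Atrac_def by blast
qed

section \<open>Infinite words\<close>

lemma subst_omega_shift: "subst_omega \<sigma> (u @- w) = subst_star \<sigma> u @- subst_omega \<sigma> w"
  by (induction u) (simp_all add: subst_star_Cons subst_omega_SCons)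

lemma subst_omega_cong: "(\<And>s. s \<in> sset w \<Longrightarrow> \<sigma> s = \<rho> s) \<Longrightarrow> subst_omega \<sigma> w = subst_omega \<rho> w"
  unfolding subst_omega_def by (metis stream.map_cong)

text \<open>Under this condition the concatenated images form an infinite word, so their finite
  prefixes determine \<open>subst_omega \<rho> w\<close>.\<close>

definition productive :: "('s \<Rightarrow> 't list) \<Rightarrow> 's stream \<Rightarrow> bool" where
  "productive \<rho> w \<longleftrightarrow> infinite {i. \<rho> (w !! i) \<noteq> []}"

lemma productive_unbounded:
  assumes "productive \<rho> w"
  shows "\<exists>k. m \<le> length (subst_star \<rho> (stake k w))"
proof (induction m)
  case (Suc m)
  then obtain k where k: "m \<le> length (subst_star \<rho> (stake k w))" by blast
  obtain n where n: "n \<ge> k" "\<rho> (w !! n) \<noteq> []"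
    using assms unfolding productive_def infinite_nat_iff_unbounded_le by blast
  have "stake n w = stake k w @ stake (n - k) (sdrop k w)"
    using n(1) by (metis le_add_diff_inverse stake_add)
  then have "stake (Suc n) w = stake k w @ stake (n - k) (sdrop k w) @ [w !! n]"
    by (simp add: stake_Suc del: stake.simps)
  then have "Suc m \<le> length (subst_star \<rho> (stake (Suc n) w))"
    using k n(2) by (cases "\<rho> (w !! n)") (simp_all add: subst_star_Cons del: stake_add stake.simps)
  then show ?case by blast
qed auto

lemma stream_eqI: "(\<And>n. s !! n = t !! n) \<Longrightarrow> s = t"
  by (metis stream_smap_nats ext)

text \<open>Both sides begin with the image of \<open>stake k w\<close> under the composite, and
  productivity makes these common prefixes arbitrarily long.\<close>

lemma subst_omega_comp:
  assumes "productive (\<lambda>s. subst_star \<sigma> (\<rho> s)) w"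
  shows "subst_omega \<sigma> (subst_omega \<rho> w) = subst_omega (\<lambda>s. subst_star \<sigma> (\<rho> s)) w"
proof (rule stream_eqI)
  let ?\<tau> = "\<lambda>s. subst_star \<sigma> (\<rho> s)"
  fix m
  obtain k where k: "Suc m \<le> length (subst_star ?\<tau> (stake k w))"
    using productive_unbounded[OF assms] by blast
  have "subst_omega \<sigma> (subst_omega \<rho> w) =
      subst_star ?\<tau> (stake k w) @- subst_omega \<sigma> (subst_omega \<rho> (sdrop k w))"
    by (subst subst_omega_prefix[of \<rho> w k]) (simp only: subst_omega_shift subst_star_comp)
  then show "subst_omega \<sigma> (subst_omega \<rho> w) !! m = subst_omega ?\<tau> w !! m"
    using k by (subst subst_omega_prefix[of ?\<tau> w k]) simp
qed

lemma subst_omega_in_streams: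
  assumes "productive \<rho> w" "w \<in> streams A" "\<And>s. s \<in> A \<Longrightarrow> \<rho> s \<in> lists B"
  shows "subst_omega \<rho> w \<in> streams B"
  unfolding streams_iff_snth
proof
  fix m
  obtain k where k: "Suc m \<le> length (subst_star \<rho> (stake k w))"
    using productive_unbounded[OF assms(1)] by blast
  have "set (stake k w) \<subseteq> A"
    using assms(2) by (auto simp: in_set_conv_nth streams_iff_snth)
  then have "set (subst_star \<rho> (stake k w)) \<subseteq> B"
    using assms(3) by (fastforce simp: subst_star_def)
  moreover have "subst_omega \<rho> w !! m = subst_star \<rho> (stake k w) ! m"
    using k by (subst subst_omega_prefix[of _ _ k]) simp
  ultimately show "subst_omega \<rho> w !! m \<in> B" using k by (metis Suc_le_lessD nth_mem subsetD)
qed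

text \<open>Nonempty images make the image of the first \<open>n\<close> letters at least
  \<open>n\<close> long. This is continuity for prefixes, which can fail when letters are
  erased.\<close>

lemma subst_omega_prefix_cong:
  assumes nonempty: "\<And>i. \<rho> (w !! i) \<noteq> []" and eq: "stake n v = stake n w"
  shows "stake n (subst_omega \<rho> v) = stake n (subst_omega \<rho> w)"
proof -
  have "k \<le> length (subst_star \<rho> (stake k w))" for k
  proof (induction k)
    case (Suc k)
    then show ?case
      using nonempty[of k] by (cases "\<rho> (w !! k)") (simp_all add: stake_Suc subst_star_Cons del: stake.simps)
  qed simp
  then show ?thesis
    using eq by (subst (1 2) subst_omega_prefix[of _ _ n]) (simp add: stake_shift)
qed

lemma subst_pow_add: "subst_star (subst_pow \<sigma> m) (subst_pow \<sigma> n s) = subst_pow \<sigma> (m + n) s"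
  unfolding subst_star_subst_pow by (simp add: subst_pow_def funpow_add)

lemma subst_pow_1: "subst_pow \<sigma> 1 = \<sigma>"
  by (rule ext) (simp add: subst_pow_def subst_star_Cons)

lemma immortal_subst_pow:
  assumes "immortal \<sigma> s"
  shows "\<exists>t \<in> set (subst_pow \<sigma> n s). immortal \<sigma> t"
  using length_filter_immortal_le[of \<sigma> "[s]" n] assms
  by (simp add: subst_pow_def Suc_le_eq filter_empty_conv del: length_greater_0_conv)
     (metis filter_empty_conv length_greater_0_conv)

lemma productiveI:
  assumes "w \<in> omega_words S \<sigma>" "\<And>s. immortal \<sigma> s \<Longrightarrow> \<rho> s \<noteq> []"
  shows "productive \<rho> w"
  unfolding productive_def
  by (rule infinite_super[where S = "{n. immortal \<sigma> (w !! n)}"])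
     (use assms in \<open>auto simp: omega_words_def\<close>)

text \<open>The infinitely many immortal letters of \<open>w\<close> have nonempty images under all
  powers, so the composition rule applies at each step.\<close>

lemma subst_omega_funpow:
  assumes w: "w \<in> omega_words S \<sigma>"
  shows "(subst_omega \<sigma> ^^ n) w = subst_omega (subst_pow \<sigma> n) w"
proof (induction n)
  case 0
  have "subst_omega (\<lambda>s. [s]) v !! n = v !! n" for v :: "'a stream" and n
  proof (induction n arbitrary: v)
    case (Suc n)
    then show ?case using subst_omega_SCons[of "\<lambda>s. [s]" "shd v" "stl v"] by simp
  qed (use subst_omega_SCons[of "\<lambda>s. [s]" "shd v" "stl v" for v] in \<open>metis append_Nil shift.simps shd_def snth.simps(1) stream.collapse stream.sel(1)\<close>)
  then have "subst_omega (\<lambda>s. [s]) w = w" by (rule stream_eqI)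
  then show ?case by (simp add: subst_pow_def)
next
  case (Suc n)
  have eq: "(\<lambda>s. subst_star \<sigma> (subst_pow \<sigma> n s)) = subst_pow \<sigma> (Suc n)"
    by (rule ext) (simp add: subst_pow_def)
  have "productive (subst_pow \<sigma> (Suc n)) w"
    by (rule productiveI[OF w]) (metis immortal_subst_pow empty_iff list.set(1))
  then show ?case
    using subst_omega_comp[of \<sigma> "subst_pow \<sigma> n" w] Suc unfolding eq by simp
qed

text \<open>The diagonal argument is applied to the histories with all mortal letters deleted: on words
  over the immortal letters the substitution \<open>\<tau>\<close> is non-erasing, hence continuous for prefixes,
  and \<open>\<sigma>\<^sup>N\<close> carries a \<open>\<tau>\<close>-history back to a \<open>\<sigma>\<close>-history.\<close>

lemma Stab_eq_Atrac_subst_omega: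
  fixes S :: "'s set"
  assumes S: "finite S" and \<sigma>: "\<sigma> \<in> S \<rightarrow> lists S"
  shows "Stab (omega_words S \<sigma>) (subst_omega \<sigma>) = Atrac (omega_words S \<sigma>) (subst_omega \<sigma>)"
proof (rule equalityI[OF Stab_subset_Atrac], rule subsetI)
  let ?X = "omega_words S \<sigma>"
  let ?f = "subst_omega \<sigma>"
  let ?\<delta> = "drop_mortal \<sigma>"
  let ?I = "{s \<in> S. immortal \<sigma> s}"
  fix x assume x: "x \<in> Atrac ?X ?f"
  obtain N where N: "\<forall>s \<in> S. mortal \<sigma> s \<longrightarrow> subst_pow \<sigma> N s = []"
    using mortality_exponent[OF S] by blast
  define \<tau> where "\<tau> s = subst_star ?\<delta> (\<sigma> s)" for s
  have "x \<in> (?f ^^ (N + k)) ` ?X" for k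
    using x unfolding Atrac_def by blast
  then have "\<forall>k. \<exists>u. u \<in> ?X \<and> (?f ^^ (N + k)) u = x"
    unfolding image_iff by metis
  then obtain u where u: "\<And>k. u k \<in> ?X" and xu: "\<And>k. (?f ^^ (N + k)) (u k) = x" by metis
  have in_S: "s \<in> S" if "s \<in> sset w" "w \<in> ?X" for s w
    using that by (auto simp: omega_words_def sset_range streams_iff_snth)
  have I_omega: "w \<in> ?X" if "w \<in> streams ?I" for w
    using that by (auto simp: omega_words_def streams_iff_snth)
  have \<delta>_pow: "subst_star ?\<delta> (subst_pow \<sigma> n s) \<noteq> []" if "immortal \<sigma> s" for n s
    using immortal_subst_pow[OF that, of n] by (auto simp: subst_star_drop_mortal filter_empty_conv)
  have pow_nonempty: "subst_pow \<sigma> n s \<noteq> []" if "immortal \<sigma> s" for n s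
    using immortal_subst_pow[OF that, of n] by auto
  have \<tau>_nonempty: "\<tau> s \<noteq> []" if "immortal \<sigma> s" for s
    using \<delta>_pow[OF that, of 1] by (simp add: \<tau>_def subst_pow_1[simplified])
  \<comment> \<open>Row \<open>j\<close> of the \<open>k\<close>-th history is
    \<open>\<sigma>^(k-j)\<close> applied to \<open>u k\<close>, with mortal letters deleted. For
    \<open>j > k\<close> the subtraction truncates, so the step relation is claimed only for
    \<open>j < k\<close>.\<close>
  define v where "v k j = subst_omega (\<lambda>s. subst_star ?\<delta> (subst_pow \<sigma> (k - j) s)) (u k)" for k j
  have vI: "v k j \<in> streams ?I" for k j
    unfolding v_def
  proof (rule subst_omega_in_streams[where A = S])
    show "productive (\<lambda>s. subst_star ?\<delta> (subst_pow \<sigma> (k - j) s)) (u k)"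
      by (rule productiveI[OF u]) (rule \<delta>_pow)
    show "u k \<in> streams S" using u by (simp add: omega_words_def)
    show "subst_star ?\<delta> (subst_pow \<sigma> (k - j) s) \<in> lists ?I" if "s \<in> S" for s
      using subst_pow_in_lists[OF \<sigma> that, of "k - j"] by (auto simp: subst_star_drop_mortal)
  qed
  have \<tau>_\<delta>: "subst_star \<tau> (subst_star ?\<delta> w) = subst_star ?\<delta> (subst_star \<sigma> w)" for w
    unfolding subst_star_comp \<tau>_def
    by (rule subst_star_cong) (simp add: drop_mortal_comp flip: subst_star_comp)
  have v_step: "subst_omega \<tau> (v k (Suc j)) = v k j" if jk: "j < k" for k j
  proof -
    have eq: "(\<lambda>s. subst_star \<tau> (subst_star ?\<delta> (subst_pow \<sigma> (k - Suc j) s))) =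
        (\<lambda>s. subst_star ?\<delta> (subst_pow \<sigma> (k - j) s))"
    proof -
      obtain d where "k - j = Suc d" "k - Suc j = d" using jk by (metis Suc_diff_Suc)
      then show ?thesis unfolding \<tau>_\<delta> by (simp add: subst_pow_def)
    qed
    have "productive (\<lambda>s. subst_star ?\<delta> (subst_pow \<sigma> (k - j) s)) (u k)"
      by (rule productiveI[OF u]) (rule \<delta>_pow)
    then show ?thesis
      using subst_omega_comp[of \<tau> "\<lambda>s. subst_star ?\<delta> (subst_pow \<sigma> (k - Suc j) s)" "u k"]
      unfolding v_def eq by simp
  qed
  have pow_\<delta>: "subst_star (subst_pow \<sigma> N) (subst_star ?\<delta> w) = subst_star (subst_pow \<sigma> N) w"
    if "set w \<subseteq> S" for w
    unfolding subst_star_comp using that by (intro subst_star_cong subst_pow_drop_mortal[OF N]) auto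
  have v_0: "subst_omega (subst_pow \<sigma> N) (v k 0) = x" for k
  proof -
    \<comment> \<open>The power \<open>\<sigma>^N\<close> erases the deleted letters itself, so this
      composite agrees on \<open>S\<close> with \<open>\<sigma>^(N+k)\<close>, which sends
      \<open>u k\<close> to \<open>x\<close>.\<close>
    let ?\<rho> = "\<lambda>s. subst_star (subst_pow \<sigma> N) (subst_star ?\<delta> (subst_pow \<sigma> k s))"
    have eq: "?\<rho> s = subst_pow \<sigma> (N + k) s" if "s \<in> S" for s
    proof -
      have "set (subst_pow \<sigma> k s) \<subseteq> S" using subst_pow_in_lists[OF \<sigma> that, of k] by auto
      then show ?thesis by (simp only: pow_\<delta> subst_pow_add)
    qed
    have "productive ?\<rho> (u k)"
    proof (rule productiveI[OF u])
      fix s assume "immortal \<sigma> s"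
      from immortal_subst_pow[OF this, of k] obtain t
        where "t \<in> set (subst_pow \<sigma> k s)" "immortal \<sigma> t" by blast
      then show "?\<rho> s \<noteq> []"
        by (intro subst_star_nonempty[of t] pow_nonempty) (simp_all add: subst_star_drop_mortal)
    qed
    then have "subst_omega (subst_pow \<sigma> N) (v k 0) = subst_omega ?\<rho> (u k)"
      unfolding v_def by (simp add: subst_omega_comp)
    also have "\<dots> = subst_omega (subst_pow \<sigma> (N + k)) (u k)"
      by (rule subst_omega_cong) (use eq in_S u in blast)
    also have "\<dots> = x"
      using xu[of k] subst_omega_funpow[OF u, of "N + k" k] by simp
    finally show ?thesis .
  qed
  \<comment> \<open>Pairing row and position turns each history into one sequence over the finite
    set \<open>S\<close>; the limit \<open>l\<close> is then unpacked into the rows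
    \<open>y j\<close>.\<close>
  obtain l where l: "\<And>n. infinite {k. \<forall>i<n. (case prod_decode i of (j, m) \<Rightarrow> v k j !! m) = l i}"
    using finite_valued_subsequence_limit[of "\<lambda>_. S" "\<lambda>_. 0" "\<lambda>k i. case prod_decode i of (j, m) \<Rightarrow> v k j !! m"]
      S vI by (fastforce simp: streams_iff_snth split: prod.splits)
  define y where "y j = smap (\<lambda>m. l (prod_encode (j, m))) nats" for j
  have agree: "\<exists>k>j. stake n (v k j) = stake n (y j) \<and> stake n (v k (Suc j)) = stake n (y (Suc j))" for j n
  proof -
    \<comment> \<open>The codes of the first \<open>n\<close> letters of rows \<open>j\<close> and
      \<open>Suc j\<close> are bounded, so one history matches both rows there; \<open>k > j\<close>
      is what \<open>v_step\<close> requires.\<close>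
    let ?E = "prod_encode ` ({j, Suc j} \<times> {..<n})"
    have "finite ?E" by simp
    then obtain b where b: "\<And>i. i \<in> ?E \<Longrightarrow> i < b"
      unfolding finite_nat_set_iff_bounded by blast
    obtain k where k: "k > j" "\<forall>i<b. (case prod_decode i of (j, m) \<Rightarrow> v k j !! m) = l i"
      using l[of b] unfolding infinite_nat_iff_unbounded by blast
    have "v k j' !! m = y j' !! m" if "j' \<in> {j, Suc j}" "m < n" for j' m
      using k(2)[rule_format, OF b[of "prod_encode (j', m)"]] that unfolding y_def by auto
    then show ?thesis
      using k(1) by (intro exI[of _ k]) (auto intro!: nth_equalityI)
  qed
  have yI: "y j !! m \<in> ?I" for j m
  proof -
    obtain k where k: "stake (Suc m) (v k j) = stake (Suc m) (y j)" using agree by blast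
    have "y j !! m = v k j !! m"
      using stake_nth[of m "Suc m" "y j"] stake_nth[of m "Suc m" "v k j"] k by (simp del: stake.simps)
    then show ?thesis using vI[of k j] by (metis streams_iff_snth)
  qed
  then have y_streams: "y j \<in> streams ?I" for j by (simp add: streams_iff_snth)
  have stake_eqI: "s = t" if "\<And>n. stake n s = stake n t" for s t :: "'s stream"
    by (rule stream_eqI) (metis that lessI stake_nth)
  have y_step: "subst_omega \<tau> (y (Suc j)) = y j" for j
  proof (rule stake_eqI)
    fix n
    obtain k where k: "k > j" "stake n (v k j) = stake n (y j)" "stake n (v k (Suc j)) = stake n (y (Suc j))"
      using agree by blast
    have "stake n (subst_omega \<tau> (y (Suc j))) = stake n (subst_omega \<tau> (v k (Suc j)))"
      using yI k(3) by (intro subst_omega_prefix_cong[symmetric] \<tau>_nonempty) auto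
    then show "stake n (subst_omega \<tau> (y (Suc j))) = stake n (y j)"
      using v_step[OF k(1)] k(2) by simp
  qed
  have y_0: "subst_omega (subst_pow \<sigma> N) (y 0) = x"
  proof (rule stake_eqI)
    fix n
    obtain k where k: "stake n (v k 0) = stake n (y 0)" using agree by blast
    have "stake n (subst_omega (subst_pow \<sigma> N) (y 0)) = stake n (subst_omega (subst_pow \<sigma> N) (v k 0))"
      using yI k by (intro subst_omega_prefix_cong[symmetric] pow_nonempty) auto
    then show "stake n (subst_omega (subst_pow \<sigma> N) (y 0)) = stake n x" by (simp add: v_0)
  qed
  define xs where "xs j = subst_omega (subst_pow \<sigma> N) (y j)" for j
  have "xs j \<in> ?X" for j
  proof -
    have "(?f ^^ n) (y j) \<in> ?X" for n
      using I_omega[OF y_streams] subst_omega_closed[OF \<sigma>] by (induction n) (auto simp: Pi_iff)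
    then show ?thesis
      unfolding xs_def using subst_omega_funpow[OF I_omega[OF y_streams], of N j] by metis
  qed
  moreover have "?f (xs (Suc j)) = xs j" for j
  proof -
    have yX: "y (Suc j) \<in> ?X" by (rule I_omega[OF y_streams])
    \<comment> \<open>\<open>\<sigma>\<close> commutes with \<open>\<sigma>^N\<close>, and
      \<open>\<sigma>^N\<close> ignores the letters that \<open>\<tau>\<close> deletes. So a step of
      \<open>\<sigma>\<close> on \<open>xs\<close> reduces to a step of \<open>\<tau>\<close> on
      \<open>y\<close>.\<close>
    have "?f (xs (Suc j)) = subst_omega (subst_pow \<sigma> (N + 1)) (y (Suc j))"
      unfolding xs_def using subst_omega_funpow[OF yX] by (metis Suc_eq_plus1 comp_apply funpow.simps(2))
    also have "\<dots> = subst_omega (\<lambda>s. subst_star (subst_pow \<sigma> N) (\<tau> s)) (y (Suc j))"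
    proof (rule subst_omega_cong)
      fix s assume "s \<in> sset (y (Suc j))"
      then have "set (\<sigma> s) \<subseteq> S" using in_S[OF _ yX] \<sigma> by auto
      then show "subst_pow \<sigma> (N + 1) s = subst_star (subst_pow \<sigma> N) (\<tau> s)"
        unfolding \<tau>_def by (simp only: pow_\<delta> flip: subst_pow_add) (simp only: subst_pow_1)
    qed
    also have "\<dots> = xs j"
    proof -
      have "productive (\<lambda>s. subst_star (subst_pow \<sigma> N) (\<tau> s)) (y (Suc j))"
      proof (rule productiveI[OF yX])
        fix s assume "immortal \<sigma> s"
        from immortal_image[OF this] obtain t where "t \<in> set (\<sigma> s)" "immortal \<sigma> t" by blast
        then show "subst_star (subst_pow \<sigma> N) (\<tau> s) \<noteq> []"
          by (intro subst_star_nonempty[of t] pow_nonempty) (simp_all add: \<tau>_def subst_star_drop_mortal)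
      qed
      then show ?thesis unfolding xs_def by (simp add: y_step flip: subst_omega_comp)
    qed
    finally show ?thesis .
  qed
  moreover have "x \<in> ?X"
    using x unfolding Atrac_def using INF_lower[of 0 UNIV "\<lambda>n. (?f ^^ n) ` ?X"] by auto
  ultimately show "x \<in> Stab ?X ?f"
    unfolding Stab_def using y_0 by (intro CollectI conjI exI[of _ xs]) (auto simp: xs_def)
qed

theorem theorem1p2:
  fixes M :: "'m set" and d :: "'m \<Rightarrow> 'm \<Rightarrow> real" and f :: "'m \<Rightarrow> 'm"
    and G :: "('g, 'h) monoid_scheme" and \<phi> :: "'g \<Rightarrow> 'g"
    and S :: "'s set" and \<sigma> :: "'s \<Rightarrow> 's list"
  shows "(Metric_space M d \<and> compact_space (Metric_space.mtopology M d) \<and>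
            continuous_map (Metric_space.mtopology M d) (Metric_space.mtopology M d) f
            \<longrightarrow> Stab M f = Atrac M f)
       \<and> (limit_group G \<and> \<phi> \<in> hom G G \<longrightarrow> Stab (carrier G) \<phi> = Atrac (carrier G) \<phi>)
       \<and> (finite S \<and> \<sigma> \<in> S \<rightarrow> lists S
            \<longrightarrow> Stab (lists S) (subst_star \<sigma>) = Atrac (lists S) (subst_star \<sigma>)
              \<and> Stab (omega_words S \<sigma>) (subst_omega \<sigma>) = Atrac (omega_words S \<sigma>) (subst_omega \<sigma>))"
proof (intro conjI impI; (elim conjE)?)
  assume M: "Metric_space M d" and "compact_space (Metric_space.mtopology M d)"
    and "continuous_map (Metric_space.mtopology M d) (Metric_space.mtopology M d) f"
  interpret Metric_space M d by (rule M)
  show "Stab M f = Atrac M f"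
    using Stab_eq_Atrac_compact[of mtopology f] Hausdorff_space_mtopology by (simp add: \<open>compact_space _\<close> \<open>continuous_map _ _ _\<close>)
next
  assume G: "limit_group G" and \<phi>: "\<phi> \<in> hom G G"
  have "group G" using G by (simp add: limit_group_def)
  with limit_group_kernels_stabilize[OF G \<phi>] show "Stab (carrier G) \<phi> = Atrac (carrier G) \<phi>"
    using Stab_eq_Atrac_hom[OF _ \<phi>] by blast
next
  assume "finite S" "\<sigma> \<in> S \<rightarrow> lists S"
  then show "Stab (lists S) (subst_star \<sigma>) = Atrac (lists S) (subst_star \<sigma>)"
    and "Stab (omega_words S \<sigma>) (subst_omega \<sigma>) = Atrac (omega_words S \<sigma>) (subst_omega \<sigma>)"
    by (rule Stab_eq_Atrac_subst_star, rule Stab_eq_Atrac_subst_omega)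
qed

end
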